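(* Let $d\ge1$ and $\Omega=[0,1]^d$. There is a constant $C>0$ depending only on $d$ such that for every sigmoidal function $\sigma:\mathbb{R}\to\mathbb{R}$, every $f\in\mathcal{B}^{1/2}(\Omega)$ and every integer $n\ge1$, $$\inf_{f_n\in \Sigma_n^\sigma}\|f - f_n\|_{L^2(\Omega)} \le C\,\|f\|_{\mathcal{B}^{1/2}(\Omega)}\,n^{-\frac{1}{2}},$$ where $$\Sigma_n^\sigma = \left\{\sum_{i=1}^n a_i\sigma(\omega_i\cdot x + b_i):\ \omega_i\in \mathbb{R}^d,\ b_i\in \mathbb{R},\ a_i\in\mathbb{C}\right\}.$$
   Context: The Fourier transform is $\hat g(\xi)=\int_{\mathbb{R}^d} g(x)e^{-2\pi \mathrm{i}\,\xi\cdot x}\,dx$, and $|\cdot|$ is the Euclidean norm. For $s\ge 0$, the spectral Barron space is $$\mathcal{B}^s(\Omega)=\Big\{f:\Omega\to\mathbb{C}:\ \|f\|_{\mathcal{B}^s(\Omega)}:=\inf_{f_e|_\Omega=f}\int_{\mathbb{R}^d}(1+|\xi|)^s|\hat f_e(\xi)|\,d\xi<\infty\Big\},$$ where the infimum is over extensions $f_e\in L^1(\mathbb{R}^d)$ of $f$. A sigmoidal function is a bounded measurable function $\sigma:\mathbb{R}\to\mathbb{R}$ with $\sigma(x)\to1$ as $x\to+\infty$ and $\sigma(x)\to0$ as $x\to-\infty$. Functions are identified when equal almost everywhere. *)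

theory Defs
  imports "HOL-Analysis.Analysis"
begin

text \<open>Measurability and integrability are with respect to Lebesgue measure throughout. A function
  on a subset \<open>S\<close> of Euclidean space is represented by a total function whose values outside \<open>S\<close>
  are ignored.\<close>

definition fourier :: "(real^'d \<Rightarrow> complex) \<Rightarrow> real^'d \<Rightarrow> complex" where
  "fourier g \<xi> =
     (LINT x|lebesgue. g x * exp (- 2 * complex_of_real pi * \<i> * complex_of_real (\<xi> \<bullet> x)))"

text \<open>Functions are identified when they agree almost everywhere, so an extension only has to
  agree with \<open>f\<close> almost everywhere on \<open>S\<close>.\<close>

definition L1_extensions :: "(real^'d) set \<Rightarrow> (real^'d \<Rightarrow> complex) \<Rightarrow> (real^'d \<Rightarrow> complex) set" where
  "L1_extensions S f = {fe. integrable lebesgue fe \<and> (AE x in lebesgue_on S. fe x = f x)}"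

text \<open>The norm takes values in \<open>[0, \<infinity>]\<close>; it is \<open>\<infinity>\<close> if there is no extension at all.\<close>

definition barron_norm :: "real \<Rightarrow> (real^'d) set \<Rightarrow> (real^'d \<Rightarrow> complex) \<Rightarrow> ennreal" where
  "barron_norm s S f =
     (INF fe\<in>L1_extensions S f.
        \<integral>\<^sup>+\<xi>. ennreal ((1 + norm \<xi>) powr s * norm (fourier fe \<xi>)) \<partial>lebesgue)"

definition barron_space :: "real \<Rightarrow> (real^'d) set \<Rightarrow> (real^'d \<Rightarrow> complex) set" where
  "barron_space s S = {f. barron_norm s S f < \<infinity>}"

definition sigmoidal :: "(real \<Rightarrow> real) \<Rightarrow> bool" where
  "sigmoidal \<sigma> \<longleftrightarrow>
     bounded (range \<sigma>) \<and> \<sigma> \<in> borel_measurable lebesgue \<and>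
     (\<sigma> \<longlongrightarrow> 1) at_top \<and> (\<sigma> \<longlongrightarrow> 0) at_bot"

definition shallow_nets :: "(real \<Rightarrow> real) \<Rightarrow> nat \<Rightarrow> (real^'d \<Rightarrow> complex) set" where
  "shallow_nets \<sigma> n =
     {(\<lambda>x. \<Sum>i=1..n. a i * complex_of_real (\<sigma> (\<omega> i \<bullet> x + b i))) | a \<omega> b. True}"

text \<open>The square root is applied to the extended integral by cases, so that a function that is not
  square-integrable has norm \<open>\<infinity>\<close>.\<close>

definition L2_norm_on :: "(real^'d) set \<Rightarrow> (real^'d \<Rightarrow> complex) \<Rightarrow> ennreal" where
  "L2_norm_on S g =
     (let I = \<integral>\<^sup>+x. ennreal ((norm (g x))\<^sup>2) \<partial>lebesgue_on S
      in if I = \<infinity> then \<infinity> else ennreal (sqrt (enn2real I)))"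

end

theory Submission
  imports Defs "HOL-Probability.Characteristic_Functions"
begin

text \<open>
  Let \<open>F\<close> be the Fourier transform of an extension of \<open>f\<close>. If the Barron integral
  \<open>B\<close> of \<open>(1 + \<bar>\<xi>\<bar>)\<^sup>1\<^sup>/\<^sup>2 \<bar>F \<xi>\<bar>\<close> is finite, then \<open>F\<close> is integrable and Fourier inversion
  (\<open>fourier_inversion\<close>) writes \<open>f\<close> on the cube as a superposition of the waves
  \<open>exp (2 \<pi> i \<xi> \<bullet> x)\<close> with weights \<open>F \<xi>\<close>. The theorem is obtained by sampling from this
  superposition, and the exponent \<open>1/2\<close> comes out of optimising the sampling density.

  Sampling single jumps of the waves would be wasteful: a wave of frequency \<open>\<xi>\<close> has total variation
  of order \<open>\<bar>\<xi>\<bar>\<close> on the cube, so such an estimator has standard deviation of order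
  \<open>\<integral> (1 + \<bar>\<xi>\<bar>) \<bar>F \<xi>\<bar> d\<xi>\<close>. Instead, a whole wave is replaced at once by a randomly shifted square
  wave. If \<open>u\<close> is uniform on \<open>[0, 1]\<close>, then \<open>(\<pi> i / 2) exp (2 \<pi> i u) square_wave (t - u)\<close> has
  mean \<open>exp (2 \<pi> i t)\<close> (\<open>cis_eq_integral_square_wave\<close>): it is an unbiased estimator whose
  modulus is bounded by \<open>\<pi>/2\<close> whatever the frequency is. In the ridge direction \<open>\<xi>\<close> a square wave
  is, on the cube, a combination of at most \<open>\<kappa> (1 + \<bar>\<xi>\<bar>)\<close> Heaviside neurons, with \<open>\<kappa>\<close>
  depending only on the dimension (\<open>ridge_square_wave_in_heaviside_nets\<close>).

  So drawing \<open>N\<close> frequencies with density \<open>p\<close> gives mean squared error at most a multiple of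
  \<open>(1/N) \<integral> \<bar>F\<bar>\<^sup>2 / p\<close> and uses about \<open>N \<kappa> \<integral> (1 + \<bar>\<xi>\<bar>) p\<close> neurons. By the Cauchy-Schwarz inequality
  the product of the two is smallest for \<open>p\<close> proportional to \<open>\<bar>F \<xi>\<bar> (1 + \<bar>\<xi>\<bar>)\<^sup>-\<^sup>1\<^sup>/\<^sup>2\<close>, where it is a
  multiple of \<open>B\<^sup>2\<close>; hence \<open>n\<close> neurons achieve squared error of order \<open>B\<^sup>2 / n\<close>
  (\<open>fourier_integral_approx_by_heaviside_nets\<close>). For this density the bounds on the
  number of neurons and on the squared norm of a sample are proportional, so one greedy choice of
  the samples controls the error and the number of neurons together (\<open>greedy_sampling\<close>).

  Finally \<open>\<sigma> (k z)\<close> tends to the Heaviside function of \<open>z\<close> as \<open>k\<close> grows, for \<open>z \<noteq> 0\<close>, which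
  turns Heaviside networks into networks with activation \<open>\<sigma>\<close> of the same size
  (\<open>heaviside_nets_approx_by_sigmoidal_nets\<close>).
\<close>

section \<open>The Fourier transform of the Gaussian\<close>

lemma
  fixes f :: "'a::euclidean_space \<Rightarrow> real \<Rightarrow> complex"
  assumes int: "\<And>b. b \<in> Basis \<Longrightarrow> integrable lborel (f b)"
  shows integrable_lborel_prod: "integrable lborel (\<lambda>x::'a. \<Prod>b\<in>Basis. f b (x \<bullet> b))"
    and integral_lborel_prod:
      "(LINT x|lborel. (\<Prod>b\<in>Basis. f b (x \<bullet> b))) = (\<Prod>b\<in>(Basis::'a set). (LINT t|lborel. f b t))"
proof -
  interpret product_sigma_finite "\<lambda>b::'a. lborel :: real measure" ..
  have [measurable]: "f b \<in> borel_measurable borel" if "b \<in> Basis" for b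
    using int[OF that] by simp
  have *: "(\<Prod>b\<in>Basis. f b ((\<Sum>j\<in>Basis. y j *\<^sub>R j) \<bullet> b)) = (\<Prod>b\<in>Basis. f b (y b))" for y
    by (intro prod.cong refl) (simp add: inner_sum_left_Basis)
  show "integrable lborel (\<lambda>x::'a. \<Prod>b\<in>Basis. f b (x \<bullet> b))"
    unfolding lborel_eq[where 'a='a]
    by (subst integrable_distr_eq) (auto simp: * intro!: product_integrable_prod int)
  show "(LINT x|lborel. (\<Prod>b\<in>Basis. f b (x \<bullet> b))) = (\<Prod>b\<in>(Basis::'a set). (LINT t|lborel. f b t))"
    unfolding lborel_eq[where 'a='a]
    by (subst integral_distr) (auto simp: * intro!: product_integral_prod int)
qed

lemma
  fixes f :: "'a::euclidean_space \<Rightarrow> 'b::{banach, second_countable_topology}"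
  assumes c: "c \<noteq> 0" and f[measurable]: "f \<in> borel_measurable borel"
  shows integrable_lborel_affine:
      "integrable lborel f \<longleftrightarrow> integrable lborel (\<lambda>x. f (t + c *\<^sub>R x))"
    and integral_lborel_affine:
      "integral\<^sup>L lborel f = \<bar>c\<bar> ^ DIM('a) *\<^sub>R (LINT x|lborel. f (t + c *\<^sub>R x))"
proof -
  show "integrable lborel f \<longleftrightarrow> integrable lborel (\<lambda>x. f (t + c *\<^sub>R x))"
  proof -
    have "integrable lborel f \<longleftrightarrow> integrable lborel (\<lambda>x. \<bar>c\<bar> ^ DIM('a) *\<^sub>R f (t + c *\<^sub>R x))"
      by (subst lborel_affine[OF c, of t]) (simp add: integrable_density integrable_distr_eq)
    also have "\<dots> \<longleftrightarrow> integrable lborel (\<lambda>x. f (t + c *\<^sub>R x))"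
      using c integrable_scaleR_right[of "inverse (\<bar>c\<bar> ^ DIM('a))" lborel
        "\<lambda>x. \<bar>c\<bar> ^ DIM('a) *\<^sub>R f (t + c *\<^sub>R x)"] by auto
    finally show ?thesis .
  qed
  show "integral\<^sup>L lborel f = \<bar>c\<bar> ^ DIM('a) *\<^sub>R (LINT x|lborel. f (t + c *\<^sub>R x))"
    using c by (subst lborel_affine[OF c, of t])
      (simp add: integral_density integral_distr)
qed

lemma borel_measurable_cis[measurable]: "cis \<in> borel_measurable borel"
  by (intro borel_measurable_continuous_onI continuous_intros)

definition gauss :: "'a::euclidean_space \<Rightarrow> real" where
  "gauss z = exp (- (norm z)\<^sup>2 / 2) / sqrt (2 * pi) ^ DIM('a)"

lemma gauss_pos: "gauss z > 0"
  by (simp add: gauss_def)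

lemma borel_measurable_gauss[measurable]: "gauss \<in> borel_measurable borel"
  unfolding gauss_def by measurable

lemma gauss_eq_prod: "gauss (z::'a::euclidean_space) = (\<Prod>b\<in>Basis. std_normal_density (z \<bullet> b))"
proof -
  have "(norm z)\<^sup>2 = (\<Sum>b\<in>Basis. (z \<bullet> b)\<^sup>2)"
    unfolding power2_norm_eq_inner euclidean_inner[of z z] by (simp add: power2_eq_square)
  then show ?thesis
    by (simp add: gauss_def std_normal_density_def prod_dividef exp_sum[symmetric] 
        sum_negf[symmetric] sum_divide_distrib)
qed

lemma cis_inner_eq_prod: "cis (s \<bullet> z) = (\<Prod>b\<in>Basis. cis ((s \<bullet> b) * (z \<bullet> b)))"
  by (simp add: euclidean_inner[of s z] cis_conv_exp exp_sum sum_distrib_left)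

lemma
  shows integrable_std_normal_cis:
      "integrable lborel (\<lambda>x. complex_of_real (std_normal_density x) * cis (t * x))"
    and integral_std_normal_cis:
      "(LINT x|lborel. complex_of_real (std_normal_density x) * cis (t * x))
         = complex_of_real (exp (- t\<^sup>2 / 2))"
proof -
  have "integrable lborel std_normal_density"
    by simp
  then show "integrable lborel (\<lambda>x. complex_of_real (std_normal_density x) * cis (t * x))"
    by (rule Bochner_Integration.integrable_bound) (auto simp: norm_mult cis_conv_exp)
  have "(LINT x|lborel. complex_of_real (std_normal_density x) * cis (t * x))
      = char std_normal_distribution t"
    unfolding char_def by (subst integral_density)
      (auto simp: cis_conv_exp scaleR_conv_of_real)
  then show "(LINT x|lborel. complex_of_real (std_normal_density x) * cis (t * x))
         = complex_of_real (exp (- t\<^sup>2 / 2))"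
    by (simp add: char_std_normal_distribution)
qed

lemma
  fixes s :: "'a::euclidean_space"
  shows integrable_gauss_cis: "integrable lborel (\<lambda>z. complex_of_real (gauss z) * cis (s \<bullet> z))"
    and integral_gauss_cis:
      "(LINT z|lborel. complex_of_real (gauss z) * cis (s \<bullet> z))
         = complex_of_real (exp (- (norm s)\<^sup>2 / 2))"
proof -
  have eq: "complex_of_real (gauss z) * cis (s \<bullet> z)
      = (\<Prod>b\<in>Basis. complex_of_real (std_normal_density (z \<bullet> b)) * cis ((s \<bullet> b) * (z \<bullet> b)))" for z
    by (simp add: gauss_eq_prod cis_inner_eq_prod prod.distrib)
  have n: "(norm s)\<^sup>2 = (\<Sum>b\<in>Basis. (s \<bullet> b)\<^sup>2)"
    unfolding power2_norm_eq_inner euclidean_inner[of s s] by (simp add: power2_eq_square)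
  show "integrable lborel (\<lambda>z. complex_of_real (gauss z) * cis (s \<bullet> z))"
    unfolding eq by (intro integrable_lborel_prod[where f="\<lambda>b t. complex_of_real (std_normal_density t) * cis ((s \<bullet> b) * t)"] integrable_std_normal_cis)
  have "(LINT z|lborel. complex_of_real (gauss z) * cis (s \<bullet> z))
      = (\<Prod>b\<in>Basis. complex_of_real (exp (- (s \<bullet> b)\<^sup>2 / 2)))"
    unfolding eq
    by (subst integral_lborel_prod[where f="\<lambda>b t. complex_of_real (std_normal_density t) * cis ((s \<bullet> b) * t)"])
      (simp_all only: integrable_std_normal_cis integral_std_normal_cis)
  also have "\<dots> = complex_of_real (exp (- (norm s)\<^sup>2 / 2))"
    by (simp add: n exp_sum[symmetric] sum_negf[symmetric] sum_divide_distrib 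
        flip: of_real_prod)
  finally show "(LINT z|lborel. complex_of_real (gauss z) * cis (s \<bullet> z))
         = complex_of_real (exp (- (norm s)\<^sup>2 / 2))" .
qed

lemma
  shows integrable_gauss: "integrable lborel (gauss :: 'a::euclidean_space \<Rightarrow> real)"
    and integral_gauss: "(LINT z|lborel. gauss (z :: 'a)) = 1"
proof -
  have "integrable lborel (\<lambda>z::'a. Re (complex_of_real (gauss z) * cis (0 \<bullet> z)))"
    using integrable_gauss_cis[of "0::'a"] by (rule integrable_Re)
  then show "integrable lborel (gauss :: 'a::euclidean_space \<Rightarrow> real)" by simp
  show "(LINT z|lborel. gauss (z :: 'a)) = 1"
    using integral_gauss_cis[of "0::'a"] of_real_eq_1_iff[where 'a=complex] by simp
qed

text \<open>The Gaussian is its own Fourier transform up to scaling, so a Gaussian multiplier on the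
  frequency side acts on the space side as averaging against the probability density \<open>gauss\<close>
  rescaled to width \<open>\<eta>\<close>.\<close>

lemma
  fixes w :: "'a::euclidean_space"
  assumes \<eta>: "\<eta> > 0"
  shows integrable_gauss_multiplier:
      "integrable lborel (\<lambda>\<xi>::'a. exp (- (norm ((2 * pi * \<eta>) *\<^sub>R \<xi>))\<^sup>2 / 2))"
    and integral_gauss_multiplier:
      "(LINT \<xi>|lborel. complex_of_real (exp (- (norm ((2 * pi * \<eta>) *\<^sub>R \<xi>))\<^sup>2 / 2)) * cis (2 * pi * (\<xi> \<bullet> w)))
         = complex_of_real (gauss (w /\<^sub>R \<eta>) / \<eta> ^ DIM('a))"
proof -
  let ?I = "LINT \<xi>|lborel. complex_of_real (exp (- (norm ((2 * pi * \<eta>) *\<^sub>R \<xi>))\<^sup>2 / 2)) * cis (2 * pi * (\<xi> \<bullet> w))"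
  let ?c = "2 * pi * \<eta>" and ?S = "sqrt (2 * pi) ^ DIM('a)"
  have c: "?c > 0" using \<eta> by simp
  have S: "?S > 0" by simp
  have e: "exp (- (norm (?c *\<^sub>R \<xi>))\<^sup>2 / 2) = ?S * gauss (0 + ?c *\<^sub>R \<xi>)" for \<xi> :: 'a
    by (simp add: gauss_def)
  have cs: "cis (2 * pi * (\<xi> \<bullet> w)) = cis ((w /\<^sub>R \<eta>) \<bullet> (0 + ?c *\<^sub>R \<xi>))" for \<xi>
    using \<eta> by (simp add: inner_commute field_simps)
  show "integrable lborel (\<lambda>\<xi>::'a. exp (- (norm (?c *\<^sub>R \<xi>))\<^sup>2 / 2))"
    unfolding e
    by (intro integrable_mult_right integrable_lborel_affine[THEN iffD1] integrable_gauss)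
      (use c in auto)
  have "complex_of_real (exp (- (norm (w /\<^sub>R \<eta>))\<^sup>2 / 2))
      = complex_of_real (?c ^ DIM('a)) *
        (LINT \<xi>|lborel. complex_of_real (gauss (0 + ?c *\<^sub>R \<xi>)) * cis ((w /\<^sub>R \<eta>) \<bullet> (0 + ?c *\<^sub>R \<xi>)))"
    unfolding integral_gauss_cis[symmetric]
    by (subst integral_lborel_affine[of ?c _ 0]) (use c in \<open>auto simp: scaleR_conv_of_real\<close>)
  also have "\<dots> = complex_of_real (?c ^ DIM('a)) / ?S *
        (LINT \<xi>|lborel. complex_of_real (exp (- (norm (?c *\<^sub>R \<xi>))\<^sup>2 / 2)) * cis (2 * pi * (\<xi> \<bullet> w)))"
    unfolding e cs using S by (simp add: mult.assoc)
  finally have eq: "complex_of_real (exp (- (norm (w /\<^sub>R \<eta>))\<^sup>2 / 2)) = complex_of_real (?c ^ DIM('a)) / ?S * ?I"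
    by simp
  have "?I = complex_of_real (exp (- (norm (w /\<^sub>R \<eta>))\<^sup>2 / 2)) * complex_of_real ?S / complex_of_real (?c ^ DIM('a))"
    unfolding eq using c S \<eta> by (simp del: of_real_mult of_real_power)
  also have "\<dots> = complex_of_real (exp (- (norm (w /\<^sub>R \<eta>))\<^sup>2 / 2) * ?S / ?c ^ DIM('a))"
    by simp
  also have "?c ^ DIM('a) = ?S * ?S * \<eta> ^ DIM('a)"
    unfolding power_mult_distrib[symmetric] real_sqrt_mult_self by simp
  also have "exp (- (norm (w /\<^sub>R \<eta>))\<^sup>2 / 2) * ?S / (?S * ?S * \<eta> ^ DIM('a)) = gauss (w /\<^sub>R \<eta>) / \<eta> ^ DIM('a)"
  proof -
    have "E * r / (r * r * h) = E / r / h" if "r > 0" for E r h :: real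
      using that by simp
    from this[OF S] show ?thesis
      unfolding gauss_def .
  qed
  finally show "?I = complex_of_real (gauss (w /\<^sub>R \<eta>) / \<eta> ^ DIM('a))" .
qed

section \<open>Fourier inversion\<close>

text \<open>Inserting a Gaussian into the inversion integral makes the double integral over \<open>x\<close> and \<open>\<xi>\<close>
  absolutely convergent. Fubini's theorem then turns the inversion integral into an average of
  \<open>f\<close> near \<open>y\<close> at scale \<open>\<eta>\<close>, and inversion is the limit \<open>\<eta> \<rightarrow> 0\<close>.\<close>

lemma fourier_gauss_summation:
  fixes f :: "'a::euclidean_space \<Rightarrow> complex"
  assumes f: "integrable lborel f" and \<eta>: "\<eta> > 0"
  defines "h \<equiv> \<lambda>\<xi>. LINT x|lborel. f x * cis (- 2 * pi * (\<xi> \<bullet> x))"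
  shows "(LINT \<xi>|lborel. h \<xi> * cis (2 * pi * (\<xi> \<bullet> y))
             * complex_of_real (exp (- (norm ((2 * pi * \<eta>) *\<^sub>R \<xi>))\<^sup>2 / 2)))
       = (LINT x|lborel. f x * complex_of_real (gauss ((y - x) /\<^sub>R \<eta>) / \<eta> ^ DIM('a)))"
proof -
  define m where "m = (\<lambda>\<xi>::'a. exp (- (norm ((2 * pi * \<eta>) *\<^sub>R \<xi>))\<^sup>2 / 2))"
  define F where "F = (\<lambda>x \<xi>::'a. f x * (complex_of_real (m \<xi>) * cis (2 * pi * (\<xi> \<bullet> (y - x)))))"
  have [measurable]: "f \<in> borel_measurable borel" "m \<in> borel_measurable borel"
    using f unfolding m_def by auto
  have m: "integrable lborel m" "\<And>\<xi>. m \<xi> \<ge> 0"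
    unfolding m_def using integrable_gauss_multiplier[OF \<eta>] by auto
  have "integrable (lborel \<Otimes>\<^sub>M lborel) (\<lambda>(x, \<xi>). F x \<xi>)"
  proof (rule lborel_pair.Fubini_integrable)
    show "case_prod F \<in> borel_measurable (lborel \<Otimes>\<^sub>M lborel)"
      unfolding F_def by measurable
    show "integrable lborel (\<lambda>x. LINT \<xi>|lborel. norm (case (x, \<xi>) of (x, \<xi>) \<Rightarrow> F x \<xi>))"
      using f m by (simp add: F_def norm_mult)
    show "AE x in lborel. integrable lborel (\<lambda>\<xi>. case (x, \<xi>) of (x, \<xi>) \<Rightarrow> F x \<xi>)"
    proof (rule AE_I2)
      fix x
      have "integrable lborel (\<lambda>\<xi>. complex_of_real (m \<xi>) * cis (2 * pi * (\<xi> \<bullet> (y - x))))"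
        by (rule Bochner_Integration.integrable_bound[OF m(1)]) (auto simp: norm_mult m)
      then show "integrable lborel (\<lambda>\<xi>. case (x, \<xi>) of (x, \<xi>) \<Rightarrow> F x \<xi>)"
        by (simp add: F_def)
    qed
  qed
  then have swap: "(LINT \<xi>|lborel. LINT x|lborel. F x \<xi>) = (LINT x|lborel. LINT \<xi>|lborel. F x \<xi>)"
    by (rule lborel_pair.Fubini_integral)
  have "(LINT x|lborel. F x \<xi>) = h \<xi> * cis (2 * pi * (\<xi> \<bullet> y)) * complex_of_real (m \<xi>)" for \<xi>
  proof -
    have "F x \<xi> = (f x * cis (- 2 * pi * (\<xi> \<bullet> x))) * (cis (2 * pi * (\<xi> \<bullet> y)) * complex_of_real (m \<xi>))" for x
      by (simp add: F_def cis_mult inner_diff_right algebra_simps)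
    then show ?thesis
      by (simp add: h_def)
  qed
  moreover have "(LINT \<xi>|lborel. F x \<xi>) = f x * complex_of_real (gauss ((y - x) /\<^sub>R \<eta>) / \<eta> ^ DIM('a))" for x
    using integral_gauss_multiplier[OF \<eta>, of "y - x"] by (simp add: F_def m_def)
  ultimately show ?thesis
    using swap by (simp add: m_def)
qed

lemma box_averages_tendsto_indicator:
  fixes x :: "'a::euclidean_space"
  assumes Q: "Q \<in> sets borel" and x: "x \<notin> frontier Q"
  shows "(\<lambda>k. LINT z|lborel. indicator Q (x + z /\<^sub>R real (Suc k)) * gauss z) \<longlonglongrightarrow> indicator Q x"
proof -
  have [measurable]: "Q \<in> sets borel" by (rule Q)
  have ev: "\<forall>\<^sub>F k in sequentially. indicator Q (x + z /\<^sub>R real (Suc k)) = (indicator Q x :: real)" for z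
  proof -
    have lim: "(\<lambda>k. x + z /\<^sub>R real (Suc k)) \<longlonglongrightarrow> x + 0 *\<^sub>R z"
      by (intro tendsto_intros LIMSEQ_inverse_real_of_nat)
    have "x \<in> interior Q \<or> x \<in> interior (- Q)"
      using x by (auto simp: frontier_def interior_complement)
    then show ?thesis
    proof
      assume "x \<in> interior Q"
      then have "\<forall>\<^sub>F k in sequentially. x + z /\<^sub>R real (Suc k) \<in> interior Q"
        using topological_tendstoD[OF lim, of "interior Q"] by simp
      then show ?thesis
        using \<open>x \<in> interior Q\<close> interior_subset[of Q]
        by (auto elim!: eventually_mono simp: indicator_def)
    next
      assume "x \<in> interior (- Q)"
      then have "\<forall>\<^sub>F k in sequentially. x + z /\<^sub>R real (Suc k) \<in> interior (- Q)"
        using topological_tendstoD[OF lim, of "interior (- Q)"] by simp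
      then show ?thesis
        using \<open>x \<in> interior (- Q)\<close> interior_subset[of "- Q"]
        by (auto elim!: eventually_mono simp: indicator_def)
    qed
  qed
  have "(\<lambda>k. LINT z|lborel. indicator Q (x + z /\<^sub>R real (Suc k)) * gauss z)
      \<longlonglongrightarrow> (LINT z|lborel. indicator Q x * gauss (z :: 'a))"
  proof (rule integral_dominated_convergence[where w="gauss :: 'a \<Rightarrow> real"])
    show "AE z in lborel. (\<lambda>k. indicator Q (x + z /\<^sub>R real (Suc k)) * gauss z) \<longlonglongrightarrow> indicator Q x * gauss z"
      by (intro AE_I2 tendsto_mult tendsto_eventually ev tendsto_const)
    show "AE z in lborel. norm (indicator Q (x + z /\<^sub>R real (Suc k)) * gauss z) \<le> gauss z" for k
      using gauss_pos[where 'a='a] by (auto simp: indicator_def less_imp_le)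
  qed (use integrable_gauss in auto)
  then show ?thesis
    by (simp add: integral_gauss)
qed

text \<open>Both sides of the Gaussian summation formula are integrated over a box before \<open>\<eta>\<close> tends to
  \<open>0\<close>. On the frequency side dominated convergence applies because \<open>h\<close> is integrable. On the space
  side the averaging can be moved from \<open>f\<close> to the indicator of the box, where it converges boundedly
  off the frontier. Thus \<open>f\<close> and the
  inversion integral have the same integral over every box, and agree almost everywhere by
  Lebesgue differentiation.\<close>

proposition fourier_inversion:
  fixes f :: "'a::euclidean_space \<Rightarrow> complex"
  defines "h \<equiv> \<lambda>\<xi>. LINT x|lborel. f x * cis (- 2 * pi * (\<xi> \<bullet> x))"
  assumes f: "integrable lborel f" and h: "integrable lborel h"
  shows "AE y in lborel. f y = (LINT \<xi>|lborel. h \<xi> * cis (2 * pi * (\<xi> \<bullet> y)))"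
proof -
  define g where "g = (\<lambda>y. LINT \<xi>|lborel. h \<xi> * cis (2 * pi * (\<xi> \<bullet> y)))"
  have [measurable]: "f \<in> borel_measurable borel" "h \<in> borel_measurable borel"
    using f h by auto
  have g_meas[measurable]: "g \<in> borel_measurable borel"
    unfolding g_def by measurable
  define B where "B = (LINT \<xi>|lborel. norm (h \<xi>))"
  have gB: "norm (g y) \<le> B" for y
    unfolding g_def B_def by (rule order_trans[OF integral_norm_bound]) (simp add: norm_mult)
  have int_box: "integrable lborel (\<lambda>y. indicator (cbox a b) y *\<^sub>R u y)"
    if "u \<in> borel_measurable borel" "\<And>y. norm (u y) \<le> B" for u :: "'a \<Rightarrow> complex" and a b
  proof (rule Bochner_Integration.integrable_bound)
    show "integrable lborel (\<lambda>y. indicator (cbox a b) y * B)"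
      by (intro integrable_mult_left integrable_real_indicator emeasure_bounded_finite bounded_cbox) auto
    show "AE y in lborel. norm (indicator (cbox a b) y *\<^sub>R u y) \<le> norm (indicator (cbox a b) y * B)"
    proof (rule AE_I2)
      fix y
      show "norm (indicator (cbox a b) y *\<^sub>R u y) \<le> norm (indicator (cbox a b) y * B)"
        using that(2)[of y] by (auto simp: indicator_def)
    qed
  qed (use that in auto)
  have box: "(LINT y|lborel. indicator (cbox a b) y *\<^sub>R f y) = (LINT y|lborel. indicator (cbox a b) y *\<^sub>R g y)"
    for a b
  proof (rule LIMSEQ_unique)
    define m where "m = (\<lambda>k (\<xi>::'a). exp (- (norm ((2 * pi * (1 / real (Suc k))) *\<^sub>R \<xi>))\<^sup>2 / 2))"
    define G where "G = (\<lambda>k y. LINT \<xi>|lborel. h \<xi> * cis (2 * pi * (\<xi> \<bullet> y)) * complex_of_real (m k \<xi>))"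
    have [measurable]: "m k \<in> borel_measurable borel" for k
      unfolding m_def by measurable
    have G_meas[measurable]: "G k \<in> borel_measurable borel" for k
      unfolding G_def by measurable
    have m01: "0 < m k \<xi>" "m k \<xi> \<le> 1" for k \<xi>
      by (auto simp: m_def)
    have m1: "(\<lambda>k. m k \<xi>) \<longlonglongrightarrow> 1" for \<xi>
    proof -
      have "(\<lambda>k. exp (- (norm ((2 * pi * inverse (real (Suc k))) *\<^sub>R \<xi>))\<^sup>2 / 2))
        \<longlonglongrightarrow> exp (- (norm ((2 * pi * 0) *\<^sub>R \<xi>))\<^sup>2 / 2)"
        by (intro tendsto_intros LIMSEQ_inverse_real_of_nat) auto
      then show ?thesis by (simp add: m_def inverse_eq_divide)
    qed
    have GB: "norm (G k y) \<le> B" for k y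
      unfolding G_def B_def
    proof (rule order_trans[OF integral_norm_bound], rule integral_mono)
      show "integrable lborel (\<lambda>\<xi>. norm (h \<xi> * cis (2 * pi * (\<xi> \<bullet> y)) * complex_of_real (m k \<xi>)))"
        by (rule Bochner_Integration.integrable_bound[OF h])
          (use m01[of k] in \<open>auto simp: norm_mult mult_left_le less_imp_le\<close>)
    qed (use h m01[of k] in \<open>auto simp: norm_mult mult_left_le less_imp_le\<close>)
    have Gg: "(\<lambda>k. G k y) \<longlonglongrightarrow> g y" for y
      unfolding G_def g_def
    proof (rule integral_dominated_convergence[where w="\<lambda>\<xi>. norm (h \<xi>)"])
      show "AE \<xi> in lborel. (\<lambda>k. h \<xi> * cis (2 * pi * (\<xi> \<bullet> y)) * complex_of_real (m k \<xi>))
          \<longlonglongrightarrow> h \<xi> * cis (2 * pi * (\<xi> \<bullet> y))"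
      proof (rule AE_I2)
        fix \<xi>
        have "(\<lambda>k. h \<xi> * cis (2 * pi * (\<xi> \<bullet> y)) * complex_of_real (m k \<xi>))
            \<longlonglongrightarrow> h \<xi> * cis (2 * pi * (\<xi> \<bullet> y)) * complex_of_real 1"
          by (intro tendsto_intros m1)
        then show "(\<lambda>k. h \<xi> * cis (2 * pi * (\<xi> \<bullet> y)) * complex_of_real (m k \<xi>))
          \<longlonglongrightarrow> h \<xi> * cis (2 * pi * (\<xi> \<bullet> y))" by simp
      qed
      show "AE \<xi> in lborel. norm (h \<xi> * cis (2 * pi * (\<xi> \<bullet> y)) * complex_of_real (m k \<xi>)) \<le> norm (h \<xi>)" for k
        using m01[of k] by (auto simp: norm_mult mult_left_le less_imp_le)
    qed (use h in auto)
    show "(\<lambda>k. LINT y|lborel. indicator (cbox a b) y *\<^sub>R G k y) \<longlonglongrightarrow> (LINT y|lborel. indicator (cbox a b) y *\<^sub>R g y)"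
    proof (rule integral_dominated_convergence[where w="\<lambda>y. indicator (cbox a b) y * B"])
      show "integrable lborel (\<lambda>y. indicator (cbox a b) y * B)"
        by (intro integrable_mult_left integrable_real_indicator emeasure_bounded_finite bounded_cbox) auto
      show "AE y in lborel. (\<lambda>k. indicator (cbox a b) y *\<^sub>R G k y) \<longlonglongrightarrow> indicator (cbox a b) y *\<^sub>R g y"
        by (intro AE_I2 tendsto_scaleR tendsto_const Gg)
    qed (use GB in \<open>auto simp: indicator_def\<close>)
    \<comment> \<open>the indicator of the box averaged at scale \<open>1 / (k + 1)\<close>\<close>
    define w where "w = (\<lambda>k x. LINT z|lborel. indicator (cbox a b) (x + z /\<^sub>R real (Suc k)) * gauss (z::'a))"
    have w_meas[measurable]: "w k \<in> borel_measurable borel" for k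
      unfolding w_def by measurable
    have wint: "integrable lborel (\<lambda>z. indicator (cbox a b) (x + z /\<^sub>R real (Suc k)) * gauss (z::'a))" for k x
      by (rule Bochner_Integration.integrable_bound[OF integrable_gauss]) (auto simp: indicator_def)
    have w0: "w k x \<ge> 0" for k x
      unfolding w_def by (intro integral_nonneg_AE AE_I2) (simp add: gauss_pos less_imp_le)
    have w1: "w k x \<le> 1" for k x
      unfolding w_def integral_gauss[where 'a='a, symmetric]
      using gauss_pos[where 'a='a] by (intro integral_mono wint integrable_gauss) (auto simp: indicator_def less_imp_le)
    have "(LINT y|lborel. indicator (cbox a b) y *\<^sub>R G k y) = (LINT x|lborel. f x * complex_of_real (w k x))" for k
    proof -
      let ?\<eta> = "1 / real (Suc k)"
      define K where "K = (\<lambda>x y. indicator (cbox a b) y * (gauss ((y - x) /\<^sub>R ?\<eta>) / ?\<eta> ^ DIM('a)))"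
      have [measurable]: "(\<lambda>(x, y). K x y) \<in> borel_measurable (borel \<Otimes>\<^sub>M borel)"
        unfolding K_def by measurable
      have K0: "K x y \<ge> 0" for x y
        by (simp add: K_def gauss_pos less_imp_le)
      have affine: "\<bar>?\<eta>\<bar> ^ DIM('a) *\<^sub>R K x (x + ?\<eta> *\<^sub>R z) = indicator (cbox a b) (x + z /\<^sub>R real (Suc k)) * gauss z" for x z
        by (simp add: K_def inverse_eq_divide)
      have Kint: "integrable lborel (K x)" and Kw: "(LINT y|lborel. K x y) = w k x" for x
      proof -
        have [measurable]: "K x \<in> borel_measurable borel" by (simp add: K_def)
        have "integrable lborel (\<lambda>z. \<bar>?\<eta>\<bar> ^ DIM('a) *\<^sub>R K x (x + ?\<eta> *\<^sub>R z))"
          unfolding affine by (rule wint)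
        then have "integrable lborel (\<lambda>z. K x (x + ?\<eta> *\<^sub>R z))"
          by simp
        then show "integrable lborel (K x)"
          by (subst integrable_lborel_affine[of ?\<eta> _ x]) auto
        show "(LINT y|lborel. K x y) = w k x"
          unfolding w_def affine[symmetric]
          by (subst integral_lborel_affine[of ?\<eta> _ x]) auto
      qed
      have "integrable (lborel \<Otimes>\<^sub>M lborel) (\<lambda>(x, y). f x * complex_of_real (K x y))"
      proof (rule lborel_pair.Fubini_integrable)
        show "(\<lambda>(x, y). f x * complex_of_real (K x y)) \<in> borel_measurable (lborel \<Otimes>\<^sub>M lborel)"
          by measurable
        have "(\<lambda>x. LINT y|lborel. norm (case (x, y) of (x, y) \<Rightarrow> f x * complex_of_real (K x y)))
            = (\<lambda>x. norm (f x) * w k x)"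
          using K0 by (simp add: norm_mult Kw)
        moreover have "integrable lborel (\<lambda>x. norm (f x) * w k x)"
          by (rule Bochner_Integration.integrable_bound[OF f])
            (use w0 w1 in \<open>auto simp: mult_left_le\<close>)
        ultimately show "integrable lborel (\<lambda>x. LINT y|lborel. norm (case (x, y) of (x, y) \<Rightarrow> f x * complex_of_real (K x y)))"
          by simp
        show "AE x in lborel. integrable lborel (\<lambda>y. case (x, y) of (x, y) \<Rightarrow> f x * complex_of_real (K x y))"
          using Kint by simp
      qed
      then have swap: "(LINT y|lborel. LINT x|lborel. f x * complex_of_real (K x y))
          = (LINT x|lborel. LINT y|lborel. f x * complex_of_real (K x y))"
        by (rule lborel_pair.Fubini_integral)
      have "indicator (cbox a b) y *\<^sub>R G k y = (LINT x|lborel. f x * complex_of_real (K x y))" for y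
      proof -
        have "G k y = (LINT x|lborel. f x * complex_of_real (gauss ((y - x) /\<^sub>R ?\<eta>) / ?\<eta> ^ DIM('a)))"
          unfolding G_def m_def h_def by (rule fourier_gauss_summation[OF f]) simp
        then show ?thesis
          by (simp add: K_def indicator_def)
      qed
      then show ?thesis
        using swap Kw by simp
    qed
    moreover have "(\<lambda>k. LINT x|lborel. f x * complex_of_real (w k x)) \<longlonglongrightarrow> (LINT y|lborel. indicator (cbox a b) y *\<^sub>R f y)"
    proof (rule integral_dominated_convergence[where w="\<lambda>x. norm (f x)"])
      have "AE x in lebesgue. x \<notin> frontier (cbox a b)"
        using negligible_frontier_interval[of a b]
        by (intro AE_not_in) (simp add: negligible_iff_null_sets frontier_cbox)
      then have "AE x in lborel. x \<notin> frontier (cbox a b)"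
        by (simp add: AE_completion_iff)
      then show "AE x in lborel. (\<lambda>k. f x * complex_of_real (w k x)) \<longlonglongrightarrow> indicator (cbox a b) x *\<^sub>R f x"
      proof eventually_elim
        case (elim x)
        have "(\<lambda>k. f x * complex_of_real (w k x)) \<longlonglongrightarrow> f x * complex_of_real (indicator (cbox a b) x)"
          unfolding w_def by (intro tendsto_intros box_averages_tendsto_indicator elim) auto
        then show ?case
          by (simp add: scaleR_conv_of_real mult.commute)
      qed
      show "AE x in lborel. norm (f x * complex_of_real (w k x)) \<le> norm (f x)" for k
        using w0 w1 by (auto simp: norm_mult mult_left_le)
    qed (use f in auto)
    ultimately show "(\<lambda>k. LINT y|lborel. indicator (cbox a b) y *\<^sub>R G k y) \<longlonglongrightarrow> (LINT y|lborel. indicator (cbox a b) y *\<^sub>R f y)"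
      by simp
  qed
  let ?u = "\<lambda>x. f x - g x"
  have fbox: "integrable lborel (\<lambda>y. indicator (cbox a b) y *\<^sub>R f y)" for a b
    by (rule Bochner_Integration.integrable_bound[OF f]) (auto simp: indicator_def)
  have ubox: "set_integrable lborel (cbox a b) ?u" for a b
    unfolding set_integrable_def scaleR_diff_right
    by (intro Bochner_Integration.integrable_diff fbox int_box g_meas gB)
  have u0: "integral (cbox a b) ?u = 0" for a b
  proof -
    have "integral (cbox a b) ?u = (LINT y:cbox a b|lborel. ?u y)"
      using set_borel_integral_eq_integral(2)[OF ubox] by simp
    also have "\<dots> = 0"
      unfolding set_lebesgue_integral_def scaleR_diff_right
      by (subst Bochner_Integration.integral_diff) (use box int_box[OF g_meas gB] fbox in auto)
    finally show ?thesis .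
  qed
  obtain N where N: "negligible N" and lim: "\<And>x e. x \<notin> N \<Longrightarrow> 0 < e \<Longrightarrow>
      \<exists>d>0. \<forall>r. 0 < r \<and> r < d \<longrightarrow> norm (integral (cbox x (x + r *\<^sub>R One)) ?u /\<^sub>R r ^ DIM('a) - ?u x) < e"
    using integrable_ccontinuous_explicit[of ?u] set_borel_integral_eq_integral(1)[OF ubox] by blast
  have u: "f x = g x" if x: "x \<notin> N" for x
  proof (rule ccontr)
    assume "f x \<noteq> g x"
    then obtain d where "d > 0" and d: "\<And>r. 0 < r \<and> r < d \<Longrightarrow>
        norm (integral (cbox x (x + r *\<^sub>R One)) ?u /\<^sub>R r ^ DIM('a) - ?u x) < norm (?u x)"
      using lim[OF x, of "norm (?u x)"] by auto
    then show False
      using d[of "d / 2"] by (simp add: u0 norm_minus_commute)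
  qed
  have "AE x in lebesgue. x \<notin> N"
    using N by (intro AE_not_in) (simp add: negligible_iff_null_sets)
  then have "AE x in lebesgue. f x = g x"
    by eventually_elim (use u in auto)
  then show ?thesis
    by (simp add: AE_completion_iff g_def)
qed

section \<open>Waves as means of shifted square waves\<close>

definition square_wave :: "real \<Rightarrow> real" where
  "square_wave s = (if even \<lfloor>2 * s\<rfloor> then 1 else - 1)"

lemma square_wave_measurable[measurable]: "square_wave \<in> borel_measurable borel"
  unfolding square_wave_def[abs_def] by measurable

lemma abs_square_wave[simp]: "\<bar>square_wave s\<bar> = 1"
  by (simp add: square_wave_def)

lemma square_wave_add_int: "square_wave (s + of_int n) = square_wave s"
proof -
  have "\<lfloor>2 * (s + of_int n)\<rfloor> = \<lfloor>2 * s\<rfloor> + 2 * n"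
    by (metis distrib_left floor_add_int of_int_mult of_int_numeral)
  then show ?thesis
    by (simp add: square_wave_def)
qed

lemma has_integral_cis:
  assumes "a \<le> b"
  shows "((\<lambda>u. cis (2 * pi * u)) has_integral (cis (2 * pi * b) - cis (2 * pi * a)) / (2 * pi * \<i>)) {a..b}"
proof -
  have "((\<lambda>u. cis (2 * pi * u) / (2 * pi * \<i>)) has_vector_derivative cis (2 * pi * u)) (at u within {a..b})" for u
  proof -
    have "((\<lambda>u. exp (2 * pi * \<i> * of_real u) / (2 * pi * \<i>)) has_vector_derivative exp (2 * pi * \<i> * of_real u)) (at u within {a..b})"
      by (rule has_vector_derivative_real_field) (auto intro!: derivative_eq_intros)
    then show ?thesis
      by (simp add: cis_conv_exp mult_ac)
  qed
  from fundamental_theorem_of_calculus[OF assms this] show ?thesis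
    by (simp add: diff_divide_distrib)
qed

text \<open>Up to the shift by \<open>t\<close>, this is the first Fourier coefficient of the square wave. By periodicity
  \<open>t\<close> may be replaced by its fractional part \<open>r\<close>; then the square wave has two jumps in the
  interval of integration, at \<open>r\<close> and at \<open>r + 1/2\<close> or \<open>r - 1/2\<close>, and the antiderivative \<open>P\<close>
  changes sign under a shift by \<open>1/2\<close>.\<close>

lemma has_integral_cis_square_wave:
  "((\<lambda>u. cis (2 * pi * u) * square_wave (t - u)) has_integral 2 / (pi * \<i>) * cis (2 * pi * t)) {0..1}"
proof -
  define r where "r = frac t"
  define P where "P = (\<lambda>u. cis (2 * pi * u) / (2 * pi * \<i>))"
  have P: "((\<lambda>u. cis (2 * pi * u)) has_integral P b - P a) {a..b}" if "a \<le> b" for a b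
    using has_integral_cis[OF that] by (simp add: P_def diff_divide_distrib)
  have half: "P (r + 1/2) = - P r" "P (r - 1/2) = - P r" and per: "P 1 = P 0"
    by (simp_all add: P_def distrib_left right_diff_distrib flip: cis_mult cis_divide)
  have r: "0 \<le> r" "r < 1"
    by (auto simp: r_def frac_lt_1)
  have t: "t = r + of_int \<lfloor>t\<rfloor>"
    by (simp add: r_def frac_def)
  have sw: "square_wave (t - u) = square_wave (r - u)" for u
    using square_wave_add_int[of "r - u" "\<lfloor>t\<rfloor>"] t by (simp add: algebra_simps)
  have ct: "cis (2 * pi * t) = cis (2 * pi * r)"
    by (subst t) (simp add: distrib_left flip: cis_mult)
  have Pr: "4 * P r = 2 / (pi * \<i>) * cis (2 * pi * r)"
    by (simp add: P_def)
  have piece: "((\<lambda>u. cis (2 * pi * u) * square_wave (r - u)) has_integral of_int s * (P b - P a)) {a..b}"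
    if "a \<le> b" and s: "\<And>u. a < u \<Longrightarrow> u < b \<Longrightarrow> square_wave (r - u) = of_int s" for a b s
  proof (rule has_integral_spike_finite[where S="{a, b}"])
    show "((\<lambda>u. of_int s * cis (2 * pi * u)) has_integral of_int s * (P b - P a)) {a..b}"
      using P[OF \<open>a \<le> b\<close>] by (rule has_integral_mult_right)
  qed (auto simp: s)
  have plus: "square_wave s = of_int 1" if "0 \<le> 2 * s \<and> 2 * s < 1 \<or> -2 \<le> 2 * s \<and> 2 * s < -1" for s
  proof -
    have "\<lfloor>2 * s\<rfloor> = 0 \<or> \<lfloor>2 * s\<rfloor> = -2"
      using that by (auto simp: floor_eq_iff)
    then show ?thesis by (auto simp: square_wave_def)
  qed
  have minus: "square_wave s = of_int (-1)" if "1 \<le> 2 * s \<and> 2 * s < 2 \<or> -1 \<le> 2 * s \<and> 2 * s < 0" for s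
  proof -
    have "\<lfloor>2 * s\<rfloor> = 1 \<or> \<lfloor>2 * s\<rfloor> = -1"
      using that by (auto simp: floor_eq_iff)
    then show ?thesis by (auto simp: square_wave_def)
  qed
  have "((\<lambda>u. cis (2 * pi * u) * square_wave (r - u)) has_integral 4 * P r) {0..1}"
  proof (cases "r < 1/2")
    case True
    have "((\<lambda>u. cis (2 * pi * u) * square_wave (r - u)) has_integral
        of_int 1 * (P r - P 0) + of_int (-1) * (P (r + 1/2) - P r) + of_int 1 * (P 1 - P (r + 1/2))) {0..1}"
      by (rule has_integral_combine[where c="r + 1/2"], use r True in simp, use r True in simp,
          rule has_integral_combine[where c=r], use r True in simp, use r True in simp)
        (use r True in \<open>intro piece plus minus; force\<close>)+
    then show ?thesis
      by (simp add: half per)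
  next
    case False
    have "((\<lambda>u. cis (2 * pi * u) * square_wave (r - u)) has_integral
        of_int (-1) * (P (r - 1/2) - P 0) + of_int 1 * (P r - P (r - 1/2)) + of_int (-1) * (P 1 - P r)) {0..1}"
      by (rule has_integral_combine[where c=r], use r False in simp, use r False in simp,
          rule has_integral_combine[where c="r - 1/2"], use r False in simp, use r False in simp)
        (use r False in \<open>intro piece plus minus; force\<close>)+
    then show ?thesis
      by (simp add: half per)
  qed
  then show ?thesis
    unfolding sw ct Pr .
qed

text \<open>A wave is a mean of randomly shifted square waves with coefficients of constant modulus. The
  uniform bound is what distinguishes this from the representation of a wave by its derivative,
  whose coefficients grow with the length of the interval.\<close>

lemma cis_eq_integral_square_wave:
  "cis (2 * pi * t)
     = pi * \<i> / 2 * (LINT u|lborel. indicator {0..1} u *\<^sub>R (cis (2 * pi * u) * square_wave (t - u)))"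
proof -
  let ?f = "\<lambda>u. cis (2 * pi * u) * complex_of_real (square_wave (t - u))"
  have "set_integrable lborel {0..1} ?f"
    unfolding set_integrable_def
  proof (rule Bochner_Integration.integrable_bound)
    show "integrable lborel (indicator {0..1::real} :: real \<Rightarrow> real)"
      by simp
  qed (auto simp: norm_mult indicator_def)
  from set_borel_integral_eq_integral(2)[OF this]
  have "(LINT u|lborel. indicator {0..1} u *\<^sub>R ?f u) = integral {0..1} ?f"
    by (simp add: set_lebesgue_integral_def)
  also have "\<dots> = 2 / (pi * \<i>) * cis (2 * pi * t)"
    by (rule integral_unique[OF has_integral_cis_square_wave])
  finally show ?thesis
    by simp
qed

section \<open>Shallow networks\<close>

lemma shallow_netsI:
  "(\<lambda>x. \<Sum>i<n. a i * complex_of_real (\<sigma> (\<omega> i \<bullet> x + b i))) \<in> shallow_nets \<sigma> n"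
  unfolding shallow_nets_def
  by (intro CollectI exI[of _ "\<lambda>i. a (i - 1)"] exI[of _ "\<lambda>i. \<omega> (i - 1)"] exI[of _ "\<lambda>i. b (i - 1)"])
    (simp add: sum.atLeast1_atMost_eq)

lemma shallow_netsE:
  assumes "g \<in> shallow_nets \<sigma> n"
  obtains a \<omega> b where "g = (\<lambda>x. \<Sum>i<n. a i * complex_of_real (\<sigma> (\<omega> i \<bullet> x + b i)))"
proof -
  obtain a \<omega> b where "g = (\<lambda>x. \<Sum>i=1..n. a i * complex_of_real (\<sigma> (\<omega> i \<bullet> x + b i)))"
    using assms unfolding shallow_nets_def by blast
  then show ?thesis
    by (intro that[of "\<lambda>i. a (Suc i)" "\<lambda>i. \<omega> (Suc i)" "\<lambda>i. b (Suc i)"]) (simp add: sum.atLeast1_atMost_eq)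
qed

lemma shallow_nets_zero: "(\<lambda>x. 0) \<in> shallow_nets \<sigma> n"
  using shallow_netsI[where a="\<lambda>i. 0"] by simp

lemma shallow_nets_scale:
  assumes "g \<in> shallow_nets \<sigma> n"
  shows "(\<lambda>x. c * g x) \<in> shallow_nets \<sigma> n"
proof -
  obtain a \<omega> b where g: "g = (\<lambda>x. \<Sum>i<n. a i * complex_of_real (\<sigma> (\<omega> i \<bullet> x + b i)))"
    using assms by (rule shallow_netsE)
  show ?thesis
    using shallow_netsI[where a="\<lambda>i. c * a i"] by (simp add: g sum_distrib_left mult.assoc)
qed

lemma shallow_nets_add:
  assumes "g \<in> shallow_nets \<sigma> m" "h \<in> shallow_nets \<sigma> n"
  shows "(\<lambda>x. g x + h x) \<in> shallow_nets \<sigma> (m + n)"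
proof -
  obtain a \<omega> b where g: "g = (\<lambda>x. \<Sum>i<m. a i * complex_of_real (\<sigma> (\<omega> i \<bullet> x + b i)))"
    using assms(1) by (rule shallow_netsE)
  obtain a' \<omega>' b' where h: "h = (\<lambda>x. \<Sum>i<n. a' i * complex_of_real (\<sigma> (\<omega>' i \<bullet> x + b' i)))"
    using assms(2) by (rule shallow_netsE)
  let ?j = "\<lambda>p q i. if i < m then p i else q (i - m)"
  have "(\<lambda>x. \<Sum>i<m + n. ?j a a' i * complex_of_real (\<sigma> (?j \<omega> \<omega>' i \<bullet> x + ?j b b' i)))
      = (\<lambda>x. g x + h x)"
  proof
    fix x
    have "{..<m + n} = {..<m} \<union> {m..<m + n}" by auto
    then have "(\<Sum>i<m + n. ?j a a' i * complex_of_real (\<sigma> (?j \<omega> \<omega>' i \<bullet> x + ?j b b' i)))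
      = (\<Sum>i<m. ?j a a' i * complex_of_real (\<sigma> (?j \<omega> \<omega>' i \<bullet> x + ?j b b' i)))
      + (\<Sum>i=m..<m + n. ?j a a' i * complex_of_real (\<sigma> (?j \<omega> \<omega>' i \<bullet> x + ?j b b' i)))"
      by (simp add: sum.union_disjoint ivl_disj_int)
    also have "(\<Sum>i=m..<m + n. ?j a a' i * complex_of_real (\<sigma> (?j \<omega> \<omega>' i \<bullet> x + ?j b b' i))) = h x"
      unfolding h by (rule sum.reindex_bij_witness[of _ "\<lambda>i. i + m" "\<lambda>i. i - m"]) auto
    finally show "(\<Sum>i<m + n. ?j a a' i * complex_of_real (\<sigma> (?j \<omega> \<omega>' i \<bullet> x + ?j b b' i))) = g x + h x"
      by (simp add: g)
  qed
  then show ?thesis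
    using shallow_netsI[where n="m + n" and a="?j a a'" and \<sigma>=\<sigma> and \<omega>="?j \<omega> \<omega>'" and b="?j b b'"] by simp
qed

lemma shallow_nets_mono:
  assumes "g \<in> shallow_nets \<sigma> m" "m \<le> n"
  shows "g \<in> shallow_nets \<sigma> n"
  using shallow_nets_add[OF assms(1) shallow_nets_zero[of \<sigma> "n - m"]] assms(2) by simp

lemma shallow_nets_sum:
  fixes N :: nat
  assumes "\<And>i. i < N \<Longrightarrow> g i \<in> shallow_nets \<sigma> (k i)"
  shows "(\<lambda>x. \<Sum>i<N. g i x) \<in> shallow_nets \<sigma> (\<Sum>i<N. k i)"
  using assms
proof (induction N)
  case 0
  then show ?case by (simp add: shallow_nets_zero)
next
  case (Suc N)
  then show ?case
    using shallow_nets_add[of "\<lambda>x. \<Sum>i<N. g i x" \<sigma> "\<Sum>i<N. k i" "g N" "k N"] by simp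
qed

definition heaviside :: "real \<Rightarrow> real" where
  "heaviside z = (if z \<ge> 0 then 1 else 0)"

text \<open>Each multiple of \<open>1/2\<close> in the interval carries a jump of height \<open>2\<close> with alternating sign. The
  term \<open>i = 0\<close> has its jump at the left end of the interval, so it is constant there and
  supplies the initial value without a separate constant term.\<close>

lemma square_wave_eq_sum_heaviside:
  fixes m :: nat
  assumes "- real m \<le> 2 * s" "2 * s < real m"
  shows "square_wave s
    = (\<Sum>i<2 * m. (- 1) ^ m * (if i = 0 then 1 else 2 * (- 1) ^ i) * heaviside (2 * s + real m - real i))"
proof -
  define k where "k = nat \<lfloor>2 * s + real m\<rfloor>"
  have "- int m \<le> \<lfloor>2 * s\<rfloor>" "\<lfloor>2 * s\<rfloor> < int m"
    using assms by (simp_all add: le_floor_iff floor_less_iff)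
  then have k: "\<lfloor>2 * s\<rfloor> = int k - int m" "k < 2 * m"
    by (auto simp: k_def)
  have "heaviside (2 * s + real m - real i) = (if i \<le> k then 1 else 0)" for i
    using k(1) by (simp add: heaviside_def le_floor_iff[symmetric]) linarith
  then have "(\<Sum>i<2 * m. (if i = 0 then 1 else 2 * (- 1) ^ i) * heaviside (2 * s + real m - real i))
      = (\<Sum>i<2 * m. if i \<le> k then (if i = 0 then 1 else 2 * (- 1) ^ i) else (0::real))"
    by (intro sum.cong) auto
  also have "\<dots> = (\<Sum>i\<le>k. if i = 0 then 1 else 2 * (- 1) ^ i)"
    using k(2) by (intro sum.mono_neutral_cong_right) auto
  also have "\<dots> = (- 1) ^ k"
    by (induction k) auto
  finally have "(\<Sum>i<2 * m. (- 1) ^ m * (if i = 0 then 1 else 2 * (- 1) ^ i) * heaviside (2 * s + real m - real i))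
     = (- 1) ^ m * (- 1 :: real) ^ k"
    by (simp add: mult.assoc flip: sum_distrib_left)
  also have "\<dots> = square_wave s"
    using k(1) by (simp add: square_wave_def add: minus_one_power_iff flip: power_add)
  finally show ?thesis ..
qed

lemma cube_prob_space: "prob_space (restrict_space lborel (cbox 0 (1 :: real^'d)))"
proof
  have "(\<Prod>b\<in>Basis. (1 :: real^'d) \<bullet> b) = 1"
    by (intro prod.neutral ballI) (auto simp: Basis_vec_def inner_axis)
  moreover have "\<forall>b\<in>Basis. 0 \<le> (1 :: real^'d) \<bullet> b"
    by (auto simp: Basis_vec_def inner_axis)
  ultimately show "emeasure (restrict_space lborel (cbox 0 (1 :: real^'d)))
      (space (restrict_space lborel (cbox 0 1))) = 1"
    by (simp add: emeasure_restrict_space space_restrict_space emeasure_lborel_cbox_eq)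
qed

lemma norm_le_sqrt_card:
  assumes "x \<in> cbox 0 (1 :: real^'d)"
  shows "norm x \<le> sqrt CARD('d)"
proof -
  have "(\<Sum>i\<in>UNIV. (x $ i)\<^sup>2) \<le> (\<Sum>i\<in>(UNIV :: 'd set). 1)"
    using assms by (intro sum_mono) (auto simp: mem_box_cart power_le_one)
  then show ?thesis
    by (simp add: norm_vec_def L2_set_def)
qed

text \<open>On the cube \<open>\<xi> \<bullet> x\<close> ranges over an interval of length proportional to \<open>\<bar>\<xi>\<bar>\<close>, and the square wave
  has two jumps per unit length.\<close>

lemma ridge_square_wave_in_heaviside_nets:
  fixes \<xi> :: "real^'d"
  assumes u: "u \<in> {0..1}"
  obtains h k where "h \<in> shallow_nets heaviside k" "real k \<le> (4 * sqrt CARD('d) + 6) * (1 + norm \<xi>)"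
    "\<And>x. x \<in> cbox 0 1 \<Longrightarrow> h x = complex_of_real (square_wave (\<xi> \<bullet> x - u))"
proof -
  define R where "R = 2 * (sqrt CARD('d) * norm \<xi> + 1)"
  define m where "m = nat \<lfloor>R\<rfloor> + 1"
  have R0: "R \<ge> 0" by (simp add: R_def)
  have m: "R < real m" "real m \<le> R + 1"
    using R0 by (auto simp: m_def) linarith+
  define h where "h = (\<lambda>x. \<Sum>i<2 * m. complex_of_real ((- 1) ^ m * (if i = 0 then 1 else 2 * (- 1) ^ i))
    * complex_of_real (heaviside ((2 *\<^sub>R \<xi>) \<bullet> x + (real m - 2 * u - real i))))"
  show ?thesis
  proof (rule that[of h "2 * m"])
    show "h \<in> shallow_nets heaviside (2 * m)"
      unfolding h_def by (rule shallow_netsI)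
    show "real (2 * m) \<le> (4 * sqrt CARD('d) + 6) * (1 + norm \<xi>)"
    proof -
      have "real (2 * m) \<le> 4 * sqrt CARD('d) * norm \<xi> + 6"
        using m(2) by (simp add: R_def)
      also have "\<dots> \<le> (4 * sqrt CARD('d) + 6) * (1 + norm \<xi>)"
        by (simp add: algebra_simps)
      finally show ?thesis .
    qed
    fix x :: "real^'d" assume "x \<in> cbox 0 1"
    then have "\<bar>\<xi> \<bullet> x\<bar> \<le> norm \<xi> * sqrt CARD('d)"
      by (intro order_trans[OF Cauchy_Schwarz_ineq2] mult_left_mono norm_le_sqrt_card) auto
    moreover have "0 \<le> u" "u \<le> 1"
      using u by auto
    ultimately have "\<bar>2 * (\<xi> \<bullet> x - u)\<bar> \<le> R"
      unfolding R_def by (simp add: mult.commute abs_le_iff)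
    then have "square_wave (\<xi> \<bullet> x - u) = (\<Sum>i<2 * m. (- 1) ^ m * (if i = 0 then 1 else 2 * (- 1) ^ i)
        * heaviside (2 * (\<xi> \<bullet> x - u) + real m - real i))"
      using m(1) by (intro square_wave_eq_sum_heaviside) linarith+
    then show "h x = complex_of_real (square_wave (\<xi> \<bullet> x - u))"
      by (simp add: h_def algebra_simps)
  qed
qed

section \<open>Sampling in mean square\<close>

lemma le_one_plus_square: "t \<le> 1 + t\<^sup>2" for t :: real
proof -
  have "2 * t \<le> t\<^sup>2 + 1"
    using zero_le_power2[of "t - 1"] by (simp add: power2_diff)
  then show ?thesis
    using zero_le_power2[of t] by linarith
qed

text \<open>The deviation of \<open>X\<close> from its mean is orthogonal to every constant \<open>r\<close>, so the squares add up. In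
  \<open>greedy_sampling\<close> the constant is the error accumulated so far, at one point \<open>x\<close>.\<close>

lemma (in prob_space)
  fixes X :: "'a \<Rightarrow> complex" and v :: "'a \<Rightarrow> real"
  assumes X[measurable]: "X \<in> borel_measurable M" and v: "integrable M v"
    and bound: "\<And>\<theta>. \<theta> \<in> space M \<Longrightarrow> (norm (X \<theta>))\<^sup>2 \<le> v \<theta>"
  shows norm_expectation_sq_le: "(norm (expectation X))\<^sup>2 \<le> expectation v"
    and nn_integral_deviation_le:
      "(\<integral>\<^sup>+\<theta>. ennreal ((norm (r + (X \<theta> - expectation X)))\<^sup>2) \<partial>M) \<le> ennreal ((norm r)\<^sup>2 + expectation v)"
proof -
  define Y where "Y = (\<lambda>\<theta>. X \<theta> - expectation X)"
  have X2: "integrable M (\<lambda>\<theta>. (norm (X \<theta>))\<^sup>2)"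
    by (rule Bochner_Integration.integrable_bound[OF v]) (auto intro!: AE_I2 order_trans[OF bound])
  have X1: "integrable M X"
  proof (rule Bochner_Integration.integrable_bound)
    show "integrable M (\<lambda>\<theta>. 1 + (norm (X \<theta>))\<^sup>2)"
      using X2 by simp
    show "AE \<theta> in M. norm (X \<theta>) \<le> norm (1 + (norm (X \<theta>))\<^sup>2)"
      by (simp add: abs_of_nonneg le_one_plus_square)
  qed simp
  have sq: "(norm (a + b))\<^sup>2 = (norm a)\<^sup>2 + 2 * (a \<bullet> b) + (norm b)\<^sup>2" for a b :: complex
    by (simp add: power2_norm_eq_inner inner_add_left inner_add_right inner_commute)
  have Y: "integrable M Y" "expectation Y = 0"
    using X1 by (simp_all add: Y_def prob_space)
  have Yeq: "(norm (Y \<theta>))\<^sup>2 = (norm (X \<theta>))\<^sup>2 - (norm (expectation X))\<^sup>2 - 2 * (expectation X \<bullet> Y \<theta>)" for \<theta>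
    using sq[of "expectation X" "Y \<theta>"] by (simp add: Y_def)
  have Y2: "integrable M (\<lambda>\<theta>. (norm (Y \<theta>))\<^sup>2)"
    unfolding Yeq using X2 Y(1) by auto
  have EY2: "expectation (\<lambda>\<theta>. (norm (Y \<theta>))\<^sup>2) = expectation (\<lambda>\<theta>. (norm (X \<theta>))\<^sup>2) - (norm (expectation X))\<^sup>2"
    unfolding Yeq using X2 Y by (simp add: prob_space)
  have le: "expectation (\<lambda>\<theta>. (norm (X \<theta>))\<^sup>2) \<le> expectation v"
    using X2 v bound by (intro integral_mono_AE) auto
  have "0 \<le> expectation (\<lambda>\<theta>. (norm (Y \<theta>))\<^sup>2)"
    by (intro integral_nonneg_AE) simp
  then show "(norm (expectation X))\<^sup>2 \<le> expectation v"
    using EY2 le by simp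
  have "(\<integral>\<^sup>+\<theta>. ennreal ((norm (r + Y \<theta>))\<^sup>2) \<partial>M) = ennreal (expectation (\<lambda>\<theta>. (norm (r + Y \<theta>))\<^sup>2))"
  proof (rule nn_integral_eq_integral)
    show "integrable M (\<lambda>\<theta>. (norm (r + Y \<theta>))\<^sup>2)"
      unfolding sq using Y2 Y(1) by auto
  qed simp
  also have "expectation (\<lambda>\<theta>. (norm (r + Y \<theta>))\<^sup>2) = (norm r)\<^sup>2 + expectation (\<lambda>\<theta>. (norm (Y \<theta>))\<^sup>2)"
    unfolding sq using Y2 Y by (simp add: prob_space)
  also have "\<dots> \<le> (norm r)\<^sup>2 + expectation v"
    using EY2 le zero_le_power2[of "norm (expectation X)"] by linarith
  finally show "(\<integral>\<^sup>+\<theta>. ennreal ((norm (r + (X \<theta> - expectation X)))\<^sup>2) \<partial>M) \<le> ennreal ((norm r)\<^sup>2 + expectation v)"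
    by (simp add: Y_def ennreal_leI)
qed

lemma (in prob_space) exists_le_nn_integral:
  assumes [measurable]: "\<psi> \<in> borel_measurable M" and le: "(\<integral>\<^sup>+\<theta>. \<psi> \<theta> \<partial>M) \<le> c" and c: "c < \<infinity>"
  shows "\<exists>\<theta>\<in>space M. \<psi> \<theta> \<le> c"
proof (rule ccontr)
  assume "\<not> (\<exists>\<theta>\<in>space M. \<psi> \<theta> \<le> c)"
  then have gt: "c < \<psi> \<theta>" if "\<theta> \<in> space M" for \<theta>
    using that by (simp add: not_le)
  have "(\<integral>\<^sup>+\<theta>. c \<partial>M) < (\<integral>\<^sup>+\<theta>. \<psi> \<theta> \<partial>M)"
  proof (rule nn_integral_less)
    show "AE \<theta> in M. c \<le> \<psi> \<theta>"
      using gt by (auto intro: less_imp_le)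
    show "\<not> (AE \<theta> in M. \<psi> \<theta> \<le> c)"
    proof
      assume "AE \<theta> in M. \<psi> \<theta> \<le> c"
      then have "AE \<theta> in M. False"
        using AE_space by eventually_elim (metis gt leD)
      then show False by simp
    qed
  qed (use c in \<open>simp_all add: emeasure_space_1\<close>)
  then show False
    using le by (simp add: emeasure_space_1)
qed

text \<open>A derandomised form of the law of large numbers in \<open>L\<^sup>2\<close>, with the samples chosen one at a
  time. Averaged over the next sample, the squared \<open>L\<^sup>2\<close> norm of the accumulated error grows by at
  most the mean of \<open>v\<close>, since the new deviation is orthogonal to the old error. The accumulated
  value of \<open>v\<close> also grows by the mean of \<open>v\<close>. Hence some choice of the next sample
  increases the sum of both by at most twice that mean. The second summand matters as much as
  the first: it will bound the number of neurons.\<close>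

proposition greedy_sampling:
  fixes \<Phi> :: "'t \<Rightarrow> 'x \<Rightarrow> complex" and v :: "'t \<Rightarrow> real"
  assumes M: "prob_space M" and L: "prob_space L"
    and \<Phi>[measurable]: "(\<lambda>(\<theta>, x). \<Phi> \<theta> x) \<in> borel_measurable (M \<Otimes>\<^sub>M L)"
    and v: "integrable M v" and v0: "\<And>\<theta>. v \<theta> \<ge> 0"
    and bound: "\<And>\<theta> x. \<theta> \<in> space M \<Longrightarrow> x \<in> space L \<Longrightarrow> (norm (\<Phi> \<theta> x))\<^sup>2 \<le> v \<theta>"
  defines "g \<equiv> \<lambda>x. LINT \<theta>|M. \<Phi> \<theta> x"
  shows "\<exists>\<theta>::nat \<Rightarrow> 't. (\<forall>i<N. \<theta> i \<in> space M) \<and>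
      (\<integral>\<^sup>+x. ennreal ((norm ((\<Sum>i<N. \<Phi> (\<theta> i) x) - of_nat N * g x))\<^sup>2) \<partial>L)
            + ennreal (\<Sum>i<N. v (\<theta> i)) \<le> ennreal (2 * real N * (LINT \<theta>|M. v \<theta>))"
proof -
  interpret M: prob_space M by (rule M)
  interpret L: prob_space L by (rule L)
  interpret P: pair_sigma_finite M L ..
  have [measurable]: "v \<in> borel_measurable M" using v by simp
  have g[measurable]: "g \<in> borel_measurable L"
    unfolding g_def by measurable
  define V where "V = (LINT \<theta>|M. v \<theta>)"
  have V0: "V \<ge> 0" unfolding V_def using v0 by (intro integral_nonneg_AE) simp
  have "\<exists>\<theta>::nat \<Rightarrow> 't. (\<forall>i<N. \<theta> i \<in> space M) \<and>
      (\<integral>\<^sup>+x. ennreal ((norm ((\<Sum>i<N. \<Phi> (\<theta> i) x) - of_nat N * g x))\<^sup>2) \<partial>L)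
            + ennreal (\<Sum>i<N. v (\<theta> i)) \<le> ennreal (2 * real N * V)"
  proof (induction N)
    case 0
    show ?case by simp
  next
    case (Suc N)
    then obtain \<theta> :: "nat \<Rightarrow> 't" where \<theta>: "\<And>i. i < N \<Longrightarrow> \<theta> i \<in> space M" and
      IH: "(\<integral>\<^sup>+x. ennreal ((norm ((\<Sum>i<N. \<Phi> (\<theta> i) x) - of_nat N * g x))\<^sup>2) \<partial>L)
            + ennreal (\<Sum>i<N. v (\<theta> i)) \<le> ennreal (2 * real N * V)"
      by blast
    define R where "R = (\<lambda>x. (\<Sum>i<N. \<Phi> (\<theta> i) x) - of_nat N * g x)"
    have [measurable]: "\<Phi> t \<in> borel_measurable L" if "t \<in> space M" for t
      using measurable_compose[OF measurable_Pair1'[OF that] \<Phi>] by simp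
    have R[measurable]: "R \<in> borel_measurable L"
      unfolding R_def using \<theta> by measurable
    define \<psi> where "\<psi> = (\<lambda>t. (\<integral>\<^sup>+x. ennreal ((norm (R x + (\<Phi> t x - g x)))\<^sup>2) \<partial>L) + ennreal (v t))"
    have \<psi>[measurable]: "\<psi> \<in> borel_measurable M"
      unfolding \<psi>_def by measurable
    have "(\<integral>\<^sup>+t. \<psi> t \<partial>M) = (\<integral>\<^sup>+t. \<integral>\<^sup>+x. ennreal ((norm (R x + (\<Phi> t x - g x)))\<^sup>2) \<partial>L \<partial>M) + ennreal V"
      unfolding \<psi>_def V_def using v v0
      by (subst nn_integral_add) (auto simp: nn_integral_eq_integral)
    also have "(\<integral>\<^sup>+t. \<integral>\<^sup>+x. ennreal ((norm (R x + (\<Phi> t x - g x)))\<^sup>2) \<partial>L \<partial>M)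
        = (\<integral>\<^sup>+x. \<integral>\<^sup>+t. ennreal ((norm (R x + (\<Phi> t x - g x)))\<^sup>2) \<partial>M \<partial>L)"
      by (rule P.Fubini'[symmetric]) measurable
    also have "\<dots> \<le> (\<integral>\<^sup>+x. ennreal ((norm (R x))\<^sup>2) + ennreal V \<partial>L)"
    proof (rule nn_integral_mono)
      fix x assume x: "x \<in> space L"
      have [measurable]: "(\<lambda>t. \<Phi> t x) \<in> borel_measurable M"
        using measurable_compose[OF measurable_Pair2'[OF x] \<Phi>] by simp
      show "(\<integral>\<^sup>+t. ennreal ((norm (R x + (\<Phi> t x - g x)))\<^sup>2) \<partial>M) \<le> ennreal ((norm (R x))\<^sup>2) + ennreal V"
        using M.nn_integral_deviation_le[OF _ v bound[OF _ x], of "R x"] V0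
        by (simp add: g_def V_def)
    qed
    also have "\<dots> = (\<integral>\<^sup>+x. ennreal ((norm (R x))\<^sup>2) \<partial>L) + ennreal V"
      by (subst nn_integral_add) (auto simp: L.emeasure_space_1)
    finally have int: "(\<integral>\<^sup>+t. \<psi> t \<partial>M) \<le> (\<integral>\<^sup>+x. ennreal ((norm (R x))\<^sup>2) \<partial>L) + ennreal V + ennreal V"
      by (simp add: add_right_mono)
    have fin: "(\<integral>\<^sup>+x. ennreal ((norm (R x))\<^sup>2) \<partial>L) + ennreal V + ennreal V < \<infinity>"
    proof -
      have "(\<integral>\<^sup>+x. ennreal ((norm (R x))\<^sup>2) \<partial>L) \<le> ennreal (2 * real N * V)"
        using IH unfolding R_def by (rule order_trans[rotated]) simp
      then show ?thesis
        by (simp add: top.not_eq_extremum[symmetric]) (metis ennreal_neq_top top_unique)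
    qed
    obtain t where t: "t \<in> space M" "\<psi> t \<le> (\<integral>\<^sup>+x. ennreal ((norm (R x))\<^sup>2) \<partial>L) + ennreal V + ennreal V"
      using M.exists_le_nn_integral[OF \<psi> int fin] by blast
    define \<theta>' where "\<theta>' = \<theta>(N := t)"
    have 1: "(\<Sum>i<Suc N. \<Phi> (\<theta>' i) x) - of_nat (Suc N) * g x = R x + (\<Phi> t x - g x)" for x
      by (simp add: \<theta>'_def R_def algebra_simps)
    have 2: "ennreal (\<Sum>i<Suc N. v (\<theta>' i)) = ennreal (\<Sum>i<N. v (\<theta> i)) + ennreal (v t)"
      using v0 by (simp add: \<theta>'_def sum_nonneg)
    have "(\<integral>\<^sup>+x. ennreal ((norm ((\<Sum>i<Suc N. \<Phi> (\<theta>' i) x) - of_nat (Suc N) * g x))\<^sup>2) \<partial>L)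
            + ennreal (\<Sum>i<Suc N. v (\<theta>' i)) = \<psi> t + ennreal (\<Sum>i<N. v (\<theta> i))"
      unfolding 1 2 \<psi>_def by (simp add: ac_simps)
    also have "\<dots> \<le> ((\<integral>\<^sup>+x. ennreal ((norm (R x))\<^sup>2) \<partial>L) + ennreal (\<Sum>i<N. v (\<theta> i))) + (ennreal V + ennreal V)"
      using add_right_mono[OF t(2), of "ennreal (\<Sum>i<N. v (\<theta> i))"] by (simp add: ac_simps)
    also have "\<dots> \<le> ennreal (2 * real N * V) + (ennreal V + ennreal V)"
      using IH unfolding R_def by (rule add_right_mono)
    also have "\<dots> = ennreal (2 * real (Suc N) * V)"
      using V0 by (simp add: ennreal_plus[symmetric] algebra_simps del: ennreal_plus)
    finally show ?case
      using t(1) \<theta> by (intro exI[of _ \<theta>']) (auto simp: \<theta>'_def less_Suc_eq)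
  qed
  then show ?thesis
    unfolding V_def by blast
qed

section \<open>Sampling frequencies and shifts\<close>

text \<open>The sampling argument. With \<open>w \<xi> = (1 + \<bar>\<xi>\<bar>)\<^sup>1\<^sup>/\<^sup>2\<close> and \<open>A = \<integral> \<bar>F\<bar> / w\<close>, frequencies are drawn with
  density \<open>p = \<bar>F\<bar> / (w A)\<close> and shifts uniformly from \<open>[0, 1]\<close>. The importance weight of a sample is
  then \<open>A w \<xi>\<close>, so its square \<open>A\<^sup>2 (1 + \<bar>\<xi>\<bar>)\<close> is proportional to the bound \<open>\<kappa> (1 + \<bar>\<xi>\<bar>)\<close>
  on the number of neurons; its mean is \<open>A B\<close>. Therefore \<open>N\<close> well chosen samples need at most
  \<open>2 \<kappa> N B / A\<close> neurons, which dictates \<open>N\<close>, and the squared error is of order \<open>A B / N\<close>, that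
  is \<open>B\<^sup>2 / n\<close>: the unknown ratio \<open>A / B\<close> cancels.\<close>

proposition fourier_integral_approx_by_heaviside_nets:
  fixes F :: "real^'d \<Rightarrow> complex" and n :: nat
  defines "q \<equiv> \<lambda>x. LINT \<xi>|lborel. F \<xi> * cis (2 * pi * (\<xi> \<bullet> x))"
    and "B \<equiv> LINT \<xi>|lborel. sqrt (1 + norm \<xi>) * norm (F \<xi>)"
    and "\<kappa> \<equiv> 4 * sqrt CARD('d) + 6"
  assumes F[measurable]: "F \<in> borel_measurable borel"
    and int: "integrable lborel (\<lambda>\<xi>. sqrt (1 + norm \<xi>) * norm (F \<xi>))"
    and B: "B > 0" and n: "n \<ge> 1"
  shows "\<exists>h\<in>shallow_nets heaviside n.
    (\<integral>\<^sup>+x. ennreal ((norm (q x - h x))\<^sup>2) \<partial>restrict_space lborel (cbox 0 1))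
      \<le> ennreal (2 * pi\<^sup>2 * \<kappa> * B\<^sup>2 / real n)"
proof -
  define L :: "(real^'d) measure" where "L = restrict_space lborel (cbox 0 1)"
  define w where "w = (\<lambda>\<xi>::real^'d. sqrt (1 + norm \<xi>))"
  have w[measurable]: "w \<in> borel_measurable borel" and w1: "w \<xi> \<ge> 1" and w2: "w \<xi> * w \<xi> = 1 + norm \<xi>" for \<xi>
    by (auto simp: w_def)
  have w0: "w \<xi> > 0" for \<xi> using w1[of \<xi>] by simp
  have intA: "integrable lborel (\<lambda>\<xi>. norm (F \<xi>) / w \<xi>)"
  proof (rule Bochner_Integration.integrable_bound[OF int])
    have "norm (F \<xi>) / w \<xi> \<le> w \<xi> * norm (F \<xi>)" for \<xi>
    proof -
      have "norm (F \<xi>) / w \<xi> \<le> norm (F \<xi>)"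
        using w1[of \<xi>] by (simp add: divide_le_eq mult_left_mono[of 1 "w \<xi>" "norm (F \<xi>)", simplified])
      also have "\<dots> \<le> w \<xi> * norm (F \<xi>)"
        using w1[of \<xi>] by (simp add: mult_right_mono[of 1 "w \<xi>" "norm (F \<xi>)", simplified])
      finally show ?thesis .
    qed
    then have "norm (norm (F \<xi>) / w \<xi>) \<le> norm (sqrt (1 + norm \<xi>) * norm (F \<xi>))" for \<xi>
      by (simp add: w_def abs_mult)
    then show "AE \<xi> in lborel. norm (norm (F \<xi>) / w \<xi>) \<le> norm (sqrt (1 + norm \<xi>) * norm (F \<xi>))"
      by (intro AE_I2)
  qed simp
  define A where "A = (LINT \<xi>|lborel. norm (F \<xi>) / w \<xi>)"
  have A: "A > 0"
  proof (rule ccontr)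
    assume "\<not> A > 0"
    moreover have "A \<ge> 0"
      unfolding A_def using w0 by (intro integral_nonneg_AE) (simp add: less_imp_le)
    ultimately have "A = 0" by simp
    then have "AE \<xi> in lborel. norm (F \<xi>) / w \<xi> = 0"
      unfolding A_def using w0 by (subst (asm) integral_nonneg_eq_0_iff_AE[OF intA]) (simp_all add: less_imp_le)
    then have "AE \<xi> in lborel. sqrt (1 + norm \<xi>) * norm (F \<xi>) = 0"
      by eventually_elim (use w0 in \<open>auto simp: less_le\<close>)
    then have "B = 0"
      unfolding B_def by (rule integral_eq_zero_AE)
    then show False using B by simp
  qed
  define p where "p = (\<lambda>\<xi>. norm (F \<xi>) / w \<xi> / A)"
  have p[measurable]: "p \<in> borel_measurable borel" and p0: "p \<xi> \<ge> 0" for \<xi>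
    unfolding p_def using A w0[of \<xi>] by auto
  have p_int: "integrable lborel p" "(LINT \<xi>|lborel. p \<xi>) = 1"
    unfolding p_def integral_divide_zero A_def[symmetric] using intA A
    by (auto simp del: divide_divide_eq_left)
  define P where "P = density lborel (\<lambda>\<xi>. ennreal (p \<xi>))"
  define U :: "real measure" where "U = restrict_space lborel {0..1}"
  have P_prob: "prob_space P"
    by standard (simp add: P_def emeasure_density nn_integral_eq_integral p_int p0)
  have U_prob: "prob_space U"
    unfolding U_def by standard (simp add: emeasure_restrict_space space_restrict_space)
  interpret P: prob_space P by (rule P_prob)
  interpret U: prob_space U by (rule U_prob)
  interpret PU: pair_prob_space P U ..
  have sets_P[measurable_cong]: "sets P = sets borel" by (simp add: P_def)
  have sets_L[measurable_cong]: "sets L = sets (restrict_space borel (cbox 0 1))"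
    unfolding L_def by (intro sets_restrict_space_cong) simp
  have sets_U[measurable_cong]: "sets U = sets (restrict_space borel {0..1})"
    unfolding U_def by (intro sets_restrict_space_cong) simp
  have id_U[measurable]: "(\<lambda>u. u) \<in> measurable U borel"
    unfolding U_def by (rule measurable_restrict_space1) simp
  have id_L[measurable]: "(\<lambda>u. u) \<in> measurable L borel"
    unfolding L_def by (rule measurable_restrict_space1) simp
  have L_prob: "prob_space L"
    unfolding L_def by (rule cube_prob_space)
  interpret L: prob_space L by (rule L_prob)
  define v where "v = (\<lambda>(\<xi>::real^'d, u::real). pi\<^sup>2 / 4 * A\<^sup>2 * (1 + norm \<xi>))"
  have v0: "v \<theta> \<ge> 0" for \<theta> by (simp add: v_def split_beta)
  have v_eq: "p \<xi> * v (\<xi>, u) = pi\<^sup>2 / 4 * A * (sqrt (1 + norm \<xi>) * norm (F \<xi>))" for \<xi> u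
    using A w0[of \<xi>] unfolding v_def p_def by (simp add: w2[symmetric] power2_eq_square flip: w_def[THEN fun_cong])
  have v_P: "integrable P (\<lambda>\<xi>. v (\<xi>, u))" "(LINT \<xi>|P. v (\<xi>, u)) = pi\<^sup>2 / 4 * A * B" for u
  proof -
    have [measurable]: "(\<lambda>\<xi>. v (\<xi>, u)) \<in> borel_measurable borel" by (simp add: v_def)
    show "integrable P (\<lambda>\<xi>. v (\<xi>, u))"
      unfolding P_def using p0 int by (subst integrable_density) (auto simp: v_eq)
    show "(LINT \<xi>|P. v (\<xi>, u)) = pi\<^sup>2 / 4 * A * B"
      unfolding P_def using p0 by (subst integral_density) (auto simp: v_eq B_def)
  qed
  have v_meas[measurable]: "v \<in> borel_measurable (P \<Otimes>\<^sub>M U)"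
    unfolding v_def by measurable
  have v_u: "v (\<xi>, u) = v (\<xi>, 0)" for \<xi> u by (simp add: v_def)
  have v_int: "integrable (P \<Otimes>\<^sub>M U) v"
  proof (rule PU.Fubini_integrable)
    have "(\<lambda>\<xi>. LINT u|U. norm (v (\<xi>, u))) = (\<lambda>\<xi>. v (\<xi>, 0))"
      using v0 by (subst v_u) (simp add: U.prob_space)
    then show "integrable P (\<lambda>\<xi>. LINT u|U. norm (v (\<xi>, u)))"
      using v_P(1) by simp
    show "AE \<xi> in P. integrable U (\<lambda>u. v (\<xi>, u))"
      by (subst v_u) simp
  qed simp
  define V where "V = pi\<^sup>2 / 4 * A * B"
  have V0: "V > 0" using A B by (simp add: V_def)
  have V: "(LINT \<theta>|(P \<Otimes>\<^sub>M U). v \<theta>) = V"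
  proof -
    have "(LINT \<theta>|(P \<Otimes>\<^sub>M U). v \<theta>) = (LINT \<xi>|P. LINT u|U. v (\<xi>, u))"
      using PU.integral_fst'[OF v_int] by simp
    also have "\<dots> = V"
      by (subst v_u) (simp add: U.prob_space v_P V_def)
    finally show ?thesis .
  qed
  \<comment> \<open>importance weight, phase of \<open>F\<close>, and the coefficient of the shifted square wave; where \<open>F\<close>
    vanishes the phase is \<open>0 / 0 = 0\<close>, on a set of probability zero\<close>
  define c where "c = (\<lambda>(\<xi>, u). complex_of_real (A * w \<xi>) * (F \<xi> / norm (F \<xi>)) * (pi * \<i> / 2) * cis (2 * pi * u))"
  define \<Phi> where "\<Phi> = (\<lambda>\<theta> x. c \<theta> * complex_of_real (square_wave (fst \<theta> \<bullet> x - snd \<theta>)))"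
  have \<Phi>_meas: "(\<lambda>(\<theta>, x). \<Phi> \<theta> x) \<in> borel_measurable ((P \<Otimes>\<^sub>M U) \<Otimes>\<^sub>M L)"
    unfolding \<Phi>_def c_def split_beta by measurable
  have \<Phi>_norm: "norm (\<Phi> (\<xi>, u) x) \<le> A * w \<xi> * (pi / 2)" for \<xi> u x
    using A w0[of \<xi>] by (simp add: \<Phi>_def c_def norm_mult norm_divide abs_mult)
  have \<Phi>_le: "(norm (\<Phi> \<theta> x))\<^sup>2 \<le> v \<theta>" for \<theta> x
  proof -
    have "(norm (\<Phi> \<theta> x))\<^sup>2 \<le> (A * w (fst \<theta>) * (pi / 2))\<^sup>2"
      using \<Phi>_norm[of "fst \<theta>" "snd \<theta>" x] by (intro power_mono) simp_all
    also have "\<dots> = v \<theta>"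
      using w2[of "fst \<theta>"] by (simp add: v_def split_beta power2_eq_square)
    finally show ?thesis .
  qed
  have \<Phi>_x[measurable]: "(\<lambda>\<theta>. \<Phi> \<theta> x) \<in> borel_measurable (P \<Otimes>\<^sub>M U)" for x
    unfolding \<Phi>_def c_def split_beta by measurable
  have q_eq: "(LINT \<theta>|(P \<Otimes>\<^sub>M U). \<Phi> \<theta> x) = q x" for x
  proof -
    have "integrable (P \<Otimes>\<^sub>M U) (\<lambda>\<theta>. \<Phi> \<theta> x)"
    proof (rule Bochner_Integration.integrable_bound)
      show "integrable (P \<Otimes>\<^sub>M U) (\<lambda>\<theta>. 1 + v \<theta>)"
        using v_int by simp
      have "norm (\<Phi> \<theta> x) \<le> 1 + v \<theta>" for \<theta>
        by (rule order_trans[OF le_one_plus_square add_left_mono[OF \<Phi>_le]])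
      then show "AE \<theta> in P \<Otimes>\<^sub>M U. norm (\<Phi> \<theta> x) \<le> norm (1 + v \<theta>)"
        using v0 by (simp add: abs_of_nonneg)
    qed simp
    from PU.integral_fst'[OF this]
    have "(LINT \<theta>|(P \<Otimes>\<^sub>M U). \<Phi> \<theta> x) = (LINT \<xi>|P. LINT u|U. \<Phi> (\<xi>, u) x)"
      by simp
    also have "(\<lambda>\<xi>. LINT u|U. \<Phi> (\<xi>, u) x)
        = (\<lambda>\<xi>. complex_of_real (A * w \<xi>) * (F \<xi> / norm (F \<xi>)) * cis (2 * pi * (\<xi> \<bullet> x)))"
    proof
      fix \<xi>
      have "(LINT u|U. \<Phi> (\<xi>, u) x) = complex_of_real (A * w \<xi>) * (F \<xi> / norm (F \<xi>)) * (pi * \<i> / 2 *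
          (LINT u|U. cis (2 * pi * u) * complex_of_real (square_wave (\<xi> \<bullet> x - u))))"
        by (simp add: \<Phi>_def c_def mult.assoc)
      also have "(LINT u|U. cis (2 * pi * u) * complex_of_real (square_wave (\<xi> \<bullet> x - u)))
          = (LINT u|lborel. indicator {0..1} u *\<^sub>R (cis (2 * pi * u) * square_wave (\<xi> \<bullet> x - u)))"
        unfolding U_def by (subst integral_restrict_space) auto
      also have "pi * \<i> / 2 * \<dots> = cis (2 * pi * (\<xi> \<bullet> x))"
        by (rule cis_eq_integral_square_wave[symmetric])
      finally show "(LINT u|U. \<Phi> (\<xi>, u) x)
        = complex_of_real (A * w \<xi>) * (F \<xi> / norm (F \<xi>)) * cis (2 * pi * (\<xi> \<bullet> x))" .
    qed
    also have "(LINT \<xi>|P. complex_of_real (A * w \<xi>) * (F \<xi> / norm (F \<xi>)) * cis (2 * pi * (\<xi> \<bullet> x)))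
       = (LINT \<xi>|lborel. p \<xi> *\<^sub>R (complex_of_real (A * w \<xi>) * (F \<xi> / norm (F \<xi>)) * cis (2 * pi * (\<xi> \<bullet> x))))"
      unfolding P_def using p0 by (subst integral_density) auto
    also have "\<dots> = q x"
      unfolding q_def
    proof (rule Bochner_Integration.integral_cong[OF refl])
      fix \<xi>
      have "complex_of_real (p \<xi>) * complex_of_real (A * w \<xi>) * (F \<xi> / norm (F \<xi>)) = F \<xi>"
        using A w0[of \<xi>] by (simp add: p_def)
      then show "p \<xi> *\<^sub>R (complex_of_real (A * w \<xi>) * (F \<xi> / norm (F \<xi>)) * cis (2 * pi * (\<xi> \<bullet> x))) = F \<xi> * cis (2 * pi * (\<xi> \<bullet> x))"
        unfolding scaleR_conv_of_real by (metis mult.assoc)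
    qed
    finally show ?thesis .
  qed
  have \<kappa>: "\<kappa> > 0" by (simp add: \<kappa>_def add_nonneg_pos)
  \<comment> \<open>the number of samples that \<open>n\<close> neurons allow, before rounding down\<close>
  define y where "y = real n * A / (2 * \<kappa> * B)"
  define N where "N = nat \<lfloor>y\<rfloor>"
  have y0: "y > 0" using A B \<kappa> n by (simp add: y_def)
  have V_y: "V = pi\<^sup>2 * \<kappa> * B\<^sup>2 / (2 * real n) * y"
    using A B \<kappa> n by (simp add: y_def V_def power2_eq_square)
  show ?thesis
  proof (cases "N = 0")
    case True
    \<comment> \<open>No sample is affordable, so the ratio \<open>A / B\<close> is small. Then \<open>V\<close>, which bounds \<open>\<bar>q\<bar>\<^sup>2\<close>,
      is already below the target, so the zero network is good enough.\<close>
    then have "y < 1"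
      using y0 by (simp add: N_def)
    then have "V \<le> pi\<^sup>2 * \<kappa> * B\<^sup>2 / (2 * real n) * 1"
      unfolding V_y using \<kappa> by (intro mult_left_mono) auto
    also have "\<dots> \<le> 2 * pi\<^sup>2 * \<kappa> * B\<^sup>2 / real n"
      using \<kappa> n by (simp add: field_simps)
    finally have V_le: "V \<le> 2 * pi\<^sup>2 * \<kappa> * B\<^sup>2 / real n" .
    have "(norm (q x))\<^sup>2 \<le> V" for x
      using PU.norm_expectation_sq_le[OF \<Phi>_x v_int \<Phi>_le] by (simp add: q_eq V)
    then have "(\<integral>\<^sup>+x. ennreal ((norm (q x - 0))\<^sup>2) \<partial>L) \<le> (\<integral>\<^sup>+x. ennreal V \<partial>L)"
      by (intro nn_integral_mono ennreal_leI) simp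
    also have "\<dots> \<le> ennreal (2 * pi\<^sup>2 * \<kappa> * B\<^sup>2 / real n)"
      using V_le by (simp add: L.emeasure_space_1 ennreal_leI)
    finally show ?thesis
      unfolding L_def by (intro bexI[OF _ shallow_nets_zero])
  next
    case False
    then have "y \<ge> 1"
      using y0 by (simp add: N_def)
    have N_floor: "real N = of_int \<lfloor>y\<rfloor>" "1 \<le> \<lfloor>y\<rfloor>"
      using \<open>y \<ge> 1\<close> by (simp_all add: N_def)
    have N_le: "real N \<le> y" and N_ge: "y / 2 \<le> real N"
      using N_floor by linarith+
    have N0: "real N > 0" using False by simp
    obtain \<theta> :: "nat \<Rightarrow> (real^'d) \<times> real" where \<theta>: "\<And>i. i < N \<Longrightarrow> \<theta> i \<in> space (P \<Otimes>\<^sub>M U)"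
      and le: "(\<integral>\<^sup>+x. ennreal ((norm ((\<Sum>i<N. \<Phi> (\<theta> i) x) - of_nat N * q x))\<^sup>2) \<partial>L)
            + ennreal (\<Sum>i<N. v (\<theta> i)) \<le> ennreal (2 * real N * V)"
      using greedy_sampling[OF PU.prob_space_axioms L_prob \<Phi>_meas v_int v0 \<Phi>_le, of N]
      unfolding q_eq V by blast
    have "\<exists>h k. h \<in> shallow_nets heaviside k \<and> real k \<le> \<kappa> * (1 + norm (fst (\<theta> i))) \<and>
       (\<forall>x\<in>cbox 0 1. h x = complex_of_real (square_wave (fst (\<theta> i) \<bullet> x - snd (\<theta> i))))" if "i < N" for i
    proof -
      have "snd (\<theta> i) \<in> {0..1}"
        using \<theta>[OF that] by (auto simp: space_pair_measure U_def space_restrict_space)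
      from ridge_square_wave_in_heaviside_nets[OF this, of "fst (\<theta> i)"] show ?thesis
        unfolding \<kappa>_def by metis
    qed
    then obtain hh k where hh: "\<And>i. i < N \<Longrightarrow> hh i \<in> shallow_nets heaviside (k i)"
      and k: "\<And>i. i < N \<Longrightarrow> real (k i) \<le> \<kappa> * (1 + norm (fst (\<theta> i)))"
      and hh_eq: "\<And>i x. i < N \<Longrightarrow> x \<in> cbox 0 1 \<Longrightarrow> hh i x = complex_of_real (square_wave (fst (\<theta> i) \<bullet> x - snd (\<theta> i)))"
      by metis
    define h where "h = (\<lambda>x. \<Sum>i<N. c (\<theta> i) / of_nat N * hh i x)"
    have "h \<in> shallow_nets heaviside (\<Sum>i<N. k i)"
      unfolding h_def by (intro shallow_nets_sum shallow_nets_scale hh)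
    moreover have "(\<Sum>i<N. k i) \<le> n"
    proof -
      \<comment> \<open>\<open>v\<close> is proportional to the bound on the number of neurons\<close>
      have "ennreal (\<Sum>i<N. v (\<theta> i)) \<le> ennreal (2 * real N * V)"
        by (rule order_trans[OF _ le]) simp
      then have sum_v: "(\<Sum>i<N. v (\<theta> i)) \<le> 2 * real N * V"
        using V0 by (subst (asm) ennreal_le_iff) auto
      have "real (\<Sum>i<N. k i) \<le> (\<Sum>i<N. \<kappa> * (1 + norm (fst (\<theta> i))))"
        unfolding of_nat_sum by (intro sum_mono k) simp
      also have "\<dots> = (\<Sum>i<N. 4 * \<kappa> / (pi\<^sup>2 * A\<^sup>2) * v (\<theta> i))"
        using A by (intro sum.cong) (auto simp: v_def split_beta)
      also have "\<dots> \<le> 4 * \<kappa> / (pi\<^sup>2 * A\<^sup>2) * (2 * real N * V)"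
        unfolding sum_distrib_left[symmetric] using \<kappa> by (intro mult_left_mono sum_v) auto
      also have "\<dots> = 2 * \<kappa> * B / A * real N"
        using A by (simp add: V_def power2_eq_square field_simps)
      also have "\<dots> \<le> 2 * \<kappa> * B / A * y"
        using \<kappa> A B by (intro mult_left_mono N_le) auto
      also have "\<dots> = real n"
        using \<kappa> A B by (simp add: y_def)
      finally show ?thesis by (simp only: of_nat_le_iff)
    qed
    ultimately have h_net: "h \<in> shallow_nets heaviside n"
      by (rule shallow_nets_mono)
    have "(\<integral>\<^sup>+x. ennreal ((norm (q x - h x))\<^sup>2) \<partial>L)
        = (\<integral>\<^sup>+x. ennreal (1 / (real N)\<^sup>2) * ennreal ((norm ((\<Sum>i<N. \<Phi> (\<theta> i) x) - of_nat N * q x))\<^sup>2) \<partial>L)"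
    proof (rule nn_integral_cong)
      fix x assume "x \<in> space L"
      then have x: "x \<in> cbox 0 1"
        by (simp add: L_def space_restrict_space)
      have "of_nat N * h x = (\<Sum>i<N. \<Phi> (\<theta> i) x)"
        unfolding h_def sum_distrib_left \<Phi>_def using N0 hh_eq[OF _ x] by (intro sum.cong) auto
      then have "(\<Sum>i<N. \<Phi> (\<theta> i) x) - of_nat N * q x = of_nat N * (h x - q x)"
        by (simp add: right_diff_distrib)
      then have "norm ((\<Sum>i<N. \<Phi> (\<theta> i) x) - of_nat N * q x) = real N * norm (q x - h x)"
        by (simp add: norm_mult norm_minus_commute)
      then show "ennreal ((norm (q x - h x))\<^sup>2)
        = ennreal (1 / (real N)\<^sup>2) * ennreal ((norm ((\<Sum>i<N. \<Phi> (\<theta> i) x) - of_nat N * q x))\<^sup>2)"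
        using N0 by (simp add: power_mult_distrib flip: ennreal_mult)
    qed
    also have "\<dots> = ennreal (1 / (real N)\<^sup>2) * (\<integral>\<^sup>+x. ennreal ((norm ((\<Sum>i<N. \<Phi> (\<theta> i) x) - of_nat N * q x))\<^sup>2) \<partial>L)"
    proof (rule nn_integral_cmult)
      have [measurable]: "q \<in> borel_measurable borel"
        unfolding q_def by measurable
      have [measurable]: "\<Phi> t \<in> borel_measurable L" for t
        unfolding \<Phi>_def by measurable
      show "(\<lambda>x. ennreal ((norm ((\<Sum>i<N. \<Phi> (\<theta> i) x) - of_nat N * q x))\<^sup>2)) \<in> borel_measurable L"
        by measurable
    qed
    also have "\<dots> \<le> ennreal (1 / (real N)\<^sup>2) * ennreal (2 * real N * V)"
      by (intro mult_left_mono order_trans[OF _ le]) auto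
    also have "\<dots> = ennreal (2 * V / real N)"
      using N0 V0 by (simp add: power2_eq_square flip: ennreal_mult)
    also have "2 * V / real N \<le> 2 * V / (y / 2)"
      using N_ge y0 V0 N0 by (intro divide_left_mono) auto
    also have "\<dots> = 2 * pi\<^sup>2 * \<kappa> * B\<^sup>2 / real n"
      unfolding V_y using y0 by simp
    finally show ?thesis
      using h_net by (auto simp: L_def ennreal_leI)
  qed
qed

section \<open>From Heaviside to sigmoidal neurons\<close>

text \<open>The envelope \<open>E r\<close> is the supremum of the deviation over \<open>\<bar>s\<bar> \<ge> r\<close>. It is monotone, hence Borel
  measurable, which makes it suitable for integration even though \<open>x \<mapsto> \<sigma> (\<omega> \<bullet> x + b)\<close> need
  not be a Borel function.\<close>

lemma sigmoidal_deviation_envelope: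
  assumes \<sigma>: "sigmoidal \<sigma>"
  obtains E K where "E \<in> borel_measurable borel" "(E \<longlongrightarrow> 0) at_top"
    "\<And>r. 0 \<le> E r" "\<And>r. E r \<le> K" "\<And>s. \<bar>\<sigma> s - heaviside s\<bar> \<le> E \<bar>s\<bar>"
proof -
  obtain B where B: "\<And>s. \<bar>\<sigma> s\<bar> \<le> B"
    using \<sigma> by (auto simp: sigmoidal_def bounded_iff)
  define D where "D = (\<lambda>s. \<bar>\<sigma> s - heaviside s\<bar>)"
  define E where "E = (\<lambda>r. SUP s\<in>{s. r \<le> \<bar>s\<bar>}. D s)"
  have D: "0 \<le> D s" "D s \<le> B + 1" for s
    using B[of s] by (auto simp: D_def heaviside_def)
  then have bdd: "bdd_above (D ` A)" for A
    by (intro bdd_aboveI[of _ "B + 1"]) auto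
  have ne: "{s::real. r \<le> \<bar>s\<bar>} \<noteq> {}" for r
    by (auto intro: exI[of _ "\<bar>r\<bar>"])
  have DE: "D s \<le> E r" if "r \<le> \<bar>s\<bar>" for r s
    unfolding E_def using that by (intro cSUP_upper bdd) auto
  have EK: "E r \<le> k" if "\<And>s. r \<le> \<bar>s\<bar> \<Longrightarrow> D s \<le> k" for r k
    unfolding E_def using that by (intro cSUP_least ne) auto
  have E0: "0 \<le> E r" for r
    by (rule order_trans[OF D(1) DE[of r "\<bar>r\<bar>"]]) simp
  have "mono (\<lambda>r. - E r)"
    by (rule monoI) (auto intro!: EK DE)
  from borel_measurable_uminus[OF borel_measurable_mono[OF this]]
  have "E \<in> borel_measurable borel"
    by simp
  moreover have "(E \<longlongrightarrow> 0) at_top"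
  proof (rule tendstoI)
    fix e :: real assume "e > 0"
    then have "e / 2 > 0" by simp
    have "(\<sigma> \<longlongrightarrow> 1) at_top" "(\<sigma> \<longlongrightarrow> 0) at_bot"
      using \<sigma> by (auto simp: sigmoidal_def)
    from this[THEN tendstoD, OF \<open>e / 2 > 0\<close>] obtain T T' where
      T: "\<And>s. s \<ge> T \<Longrightarrow> \<bar>\<sigma> s - 1\<bar> < e / 2" and T': "\<And>s. s \<le> T' \<Longrightarrow> \<bar>\<sigma> s\<bar> < e / 2"
      by (auto simp: eventually_at_top_linorder eventually_at_bot_linorder dist_real_def)
    have "E r \<le> e / 2" if "r \<ge> max 1 (max T (- T'))" for r
    proof (rule EK)
      fix s assume "r \<le> \<bar>s\<bar>"
      then have "s \<ge> 0 \<and> s \<ge> T \<or> s < 0 \<and> s \<le> T'"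
        using that by auto
      then show "D s \<le> e / 2"
        using T[of s] T'[of s] by (auto simp: D_def heaviside_def)
    qed
    then have "E r < e" if "r \<ge> max 1 (max T (- T'))" for r
      using that \<open>e > 0\<close> by (smt (verit) field_sum_of_halves)
    then show "\<forall>\<^sub>F r in at_top. dist (E r) 0 < e"
      using E0 unfolding eventually_at_top_linorder
      by (intro exI[of _ "max 1 (max T (- T'))"]) (auto simp: dist_real_def)
  qed
  ultimately show ?thesis
    using E0 EK[of _ "B + 1"] D DE by (intro that[of E "B + 1"]) (auto simp: D_def)
qed

text \<open>Steepen the neurons: away from the zeros of \<open>z i\<close>, which form a null set, \<open>\<sigma> (k * z i x)\<close>
  tends to \<open>heaviside (z i x)\<close>. Dominated convergence is applied to the measurable upper bound
  \<open>G k\<close> of the error, built from the envelope.\<close>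

lemma heaviside_nets_approx_by_sigmoidal_nets:
  fixes h q :: "real^'d \<Rightarrow> complex"
  assumes \<sigma>: "sigmoidal \<sigma>" and h: "h \<in> shallow_nets heaviside n"
    and q[measurable]: "q \<in> borel_measurable borel" and qB: "\<And>x. norm (q x) \<le> B"
    and less: "(\<integral>\<^sup>+x. ennreal ((norm (q x - h x))\<^sup>2) \<partial>restrict_space lborel (cbox 0 1)) < c"
  shows "\<exists>g\<in>shallow_nets \<sigma> n. (\<integral>\<^sup>+x. ennreal ((norm (q x - g x))\<^sup>2) \<partial>restrict_space lborel (cbox 0 1)) < c"
proof -
  define L :: "(real^'d) measure" where "L = restrict_space lborel (cbox 0 1)"
  interpret L: prob_space L
    unfolding L_def by (rule cube_prob_space)
  have toL: "f \<in> borel_measurable L" if "f \<in> borel_measurable borel" for f :: "real^'d \<Rightarrow> real"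
    using that unfolding L_def by (intro measurable_restrict_space1) simp
  obtain E K where E[measurable]: "E \<in> borel_measurable borel" and E_lim: "(E \<longlongrightarrow> 0) at_top"
    and E0: "\<And>r. 0 \<le> E r" and EK: "\<And>r. E r \<le> K" and E: "\<And>s. \<bar>\<sigma> s - heaviside s\<bar> \<le> E \<bar>s\<bar>"
    using sigmoidal_deviation_envelope[OF \<sigma>] by blast
  obtain a \<omega> b where h_eq: "h = (\<lambda>x. \<Sum>i<n. a i * complex_of_real (heaviside (\<omega> i \<bullet> x + b i)))"
    using h by (rule shallow_netsE)
  \<comment> \<open>A neuron with zero weight is constant, and steepening fails if its bias is \<open>0\<close>; a bias of
    \<open>1\<close> or \<open>- 1\<close> gives the same Heaviside neuron and avoids this.\<close>
  define b' where "b' = (\<lambda>i. if \<omega> i = 0 then if b i \<ge> 0 then 1 else - 1 else b i)"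
  define z where "z = (\<lambda>i x. \<omega> i \<bullet> x + b' i)"
  have z_meas[measurable]: "z i \<in> borel_measurable borel" for i
    unfolding z_def by measurable
  have [measurable]: "heaviside \<in> borel_measurable borel"
    unfolding heaviside_def[abs_def] by measurable
  have hz: "h = (\<lambda>x. \<Sum>i<n. a i * complex_of_real (heaviside (z i x)))"
    unfolding h_eq z_def b'_def by (intro ext sum.cong) (auto simp: heaviside_def)
  have h_meas[measurable]: "h \<in> borel_measurable borel"
    unfolding hz by measurable
  define A where "A = (\<Sum>i<n. norm (a i))"
  have hA: "norm (h x) \<le> A" for x
    unfolding hz A_def by (intro sum_norm_le) (auto simp: norm_mult heaviside_def)
  have z0: "AE x in L. z i x \<noteq> 0" for i
  proof -
    have "negligible {x. \<omega> i \<bullet> x = - b' i}"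
      by (rule negligible_hyperplane) (auto simp: b'_def)
    then have "AE x in lebesgue. x \<notin> {x. \<omega> i \<bullet> x = - b' i}"
      by (intro AE_not_in) (simp add: negligible_iff_null_sets)
    then have "AE x in lborel. z i x \<noteq> 0"
      unfolding AE_completion_iff by eventually_elim (auto simp: z_def)
    then show ?thesis
      unfolding L_def by (auto simp: AE_restrict_space_iff elim: eventually_mono)
  qed
  define g where "g = (\<lambda>k x. \<Sum>i<n. a i * complex_of_real (\<sigma> (real (Suc k) * z i x)))"
  define G where "G = (\<lambda>k x. norm (q x - h x) + (\<Sum>i<n. norm (a i) * E (real (Suc k) * \<bar>z i x\<bar>)))"
  have g_net: "g k \<in> shallow_nets \<sigma> n" for k
  proof -
    have "g k = (\<lambda>x. \<Sum>i<n. a i * complex_of_real (\<sigma> ((real (Suc k) *\<^sub>R \<omega> i) \<bullet> x + real (Suc k) * b' i)))"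
      by (simp add: g_def z_def distrib_left)
    also have "\<dots> \<in> shallow_nets \<sigma> n"
      by (rule shallow_netsI)
    finally show ?thesis .
  qed
  have gG: "norm (q x - g k x) \<le> G k x" for k x
  proof -
    have "norm (h x - g k x) \<le> (\<Sum>i<n. norm (a i) * E (real (Suc k) * \<bar>z i x\<bar>))"
      unfolding hz g_def sum_subtractf[symmetric]
    proof (rule sum_norm_le)
      fix i
      have "heaviside (z i x) = heaviside (real (Suc k) * z i x)"
        by (simp add: heaviside_def zero_le_mult_iff)
      then have "\<bar>heaviside (z i x) - \<sigma> (real (Suc k) * z i x)\<bar> \<le> E (real (Suc k) * \<bar>z i x\<bar>)"
        using E[of "real (Suc k) * z i x"] by (simp add: abs_mult abs_minus_commute)
      then show "norm (a i * complex_of_real (heaviside (z i x)) - a i * complex_of_real (\<sigma> (real (Suc k) * z i x)))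
          \<le> norm (a i) * E (real (Suc k) * \<bar>z i x\<bar>)"
        by (simp add: norm_mult mult_left_mono flip: right_diff_distrib of_real_diff)
    qed
    then show ?thesis
      using norm_triangle_ineq[of "q x - h x" "h x - g k x"] by (simp add: G_def)
  qed
  have G0: "0 \<le> G k x" for k x
    unfolding G_def using E0 by (intro add_nonneg_nonneg sum_nonneg) auto
  have GB: "G k x \<le> B + A + A * K" for k x
    unfolding G_def
  proof (rule add_mono)
    show "norm (q x - h x) \<le> B + A"
      by (rule order_trans[OF norm_triangle_ineq4 add_mono[OF qB hA]])
    show "(\<Sum>i<n. norm (a i) * E (real (Suc k) * \<bar>z i x\<bar>)) \<le> A * K"
      unfolding A_def sum_distrib_right by (intro sum_mono mult_left_mono EK) auto
  qed
  have lim: "AE x in L. (\<lambda>k. ennreal ((G k x)\<^sup>2)) \<longlonglongrightarrow> ennreal ((norm (q x - h x))\<^sup>2)"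
  proof -
    have "AE x in L. \<forall>i. z i x \<noteq> 0"
      using z0 by (simp add: AE_all_countable)
    then show ?thesis
    proof eventually_elim
      case (elim x)
      have "(\<lambda>k. E (real (Suc k) * \<bar>z i x\<bar>)) \<longlonglongrightarrow> 0" for i
      proof (rule filterlim_compose[OF E_lim])
        have "filterlim (\<lambda>k. real (Suc k)) at_top sequentially"
          by (rule filterlim_compose[OF filterlim_real_sequentially filterlim_Suc])
        then show "filterlim (\<lambda>k. real (Suc k) * \<bar>z i x\<bar>) at_top sequentially"
          using elim by (intro filterlim_at_top_mult_tendsto_pos[OF tendsto_const]) auto
      qed
      then have "(\<lambda>k. (G k x)\<^sup>2) \<longlonglongrightarrow> (norm (q x - h x) + (\<Sum>i<n. norm (a i) * 0))\<^sup>2"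
        unfolding G_def by (intro tendsto_intros)
      then show ?case
        by (intro tendsto_ennrealI) simp
    qed
  qed
  have "(\<lambda>k. \<integral>\<^sup>+x. ennreal ((G k x)\<^sup>2) \<partial>L) \<longlonglongrightarrow> (\<integral>\<^sup>+x. ennreal ((norm (q x - h x))\<^sup>2) \<partial>L)"
  proof (rule nn_integral_dominated_convergence[where w="\<lambda>x. ennreal ((B + A + A * K)\<^sup>2)"])
    show "(\<lambda>x. ennreal ((G k x)\<^sup>2)) \<in> borel_measurable L" for k
    proof (rule measurable_compose[OF toL measurable_ennreal])
      show "(\<lambda>x. (G k x)\<^sup>2) \<in> borel_measurable borel"
        unfolding G_def by measurable
    qed
    show "(\<lambda>x. ennreal ((norm (q x - h x))\<^sup>2)) \<in> borel_measurable L"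
      by (rule measurable_compose[OF toL measurable_ennreal]) measurable
    show "AE x in L. ennreal ((G k x)\<^sup>2) \<le> ennreal ((B + A + A * K)\<^sup>2)" for k
      using G0 GB by (intro AE_I2 ennreal_leI power_mono) auto
    show "(\<integral>\<^sup>+x. ennreal ((B + A + A * K)\<^sup>2) \<partial>L) < \<infinity>"
      by (simp add: L.emeasure_space_1)
  qed (use lim in auto)
  from order_tendstoD(2)[OF this, of c] less
  have "\<forall>\<^sub>F k in sequentially. (\<integral>\<^sup>+x. ennreal ((G k x)\<^sup>2) \<partial>L) < c"
    by (simp add: L_def)
  then obtain k where k: "(\<integral>\<^sup>+x. ennreal ((G k x)\<^sup>2) \<partial>L) < c"
    by (meson eventually_sequentially order_refl)
  have "(\<integral>\<^sup>+x. ennreal ((norm (q x - g k x))\<^sup>2) \<partial>L) \<le> (\<integral>\<^sup>+x. ennreal ((G k x)\<^sup>2) \<partial>L)"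
    using gG by (intro nn_integral_mono ennreal_leI power_mono) auto
  then show ?thesis
    using k g_net[of k] by (intro bexI[of _ "g k"]) (auto simp: L_def)
qed

section \<open>The approximation rate\<close>

lemma lebesgue_ex_borel_complex:
  fixes f :: "'a::euclidean_space \<Rightarrow> complex"
  assumes "f \<in> borel_measurable lebesgue"
  obtains g where "g \<in> borel_measurable borel" "AE x in lborel. f x = g x"
proof -
  have "(\<lambda>x. Re (f x)) \<in> borel_measurable lebesgue" "(\<lambda>x. Im (f x)) \<in> borel_measurable lebesgue"
    using assms by auto
  from this[THEN completion_ex_borel_measurable_real] obtain u v where
    [measurable]: "u \<in> borel_measurable lborel" "v \<in> borel_measurable lborel"
    and ae: "AE x in lborel. Re (f x) = u x" "AE x in lborel. Im (f x) = v x"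
    by blast
  show ?thesis
  proof (rule that[of "\<lambda>x. Complex (u x) (v x)"])
    have "(\<lambda>x. Complex (u x) (v x)) = (\<lambda>x. complex_of_real (u x) + \<i> * complex_of_real (v x))"
      by (simp add: Complex_eq)
    also have "\<dots> \<in> borel_measurable borel"
      by measurable
    finally show "(\<lambda>x. Complex (u x) (v x)) \<in> borel_measurable borel" .
    show "AE x in lborel. f x = Complex (u x) (v x)"
      using ae by eventually_elim (simp add: complex_eq_iff)
  qed
qed

lemma nn_integral_lebesgue_on:
  assumes "S \<in> sets borel"
  shows "(\<integral>\<^sup>+x. f x \<partial>lebesgue_on S) = (\<integral>\<^sup>+x. f x \<partial>restrict_space lborel S)"
  using assms by (simp add: nn_integral_restrict_space nn_integral_completion)

lemma L2_norm_on_le: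
  assumes I: "(\<integral>\<^sup>+x. ennreal ((norm (g x))\<^sup>2) \<partial>lebesgue_on S) \<le> ennreal c" and c: "c \<ge> 0"
  shows "L2_norm_on S g \<le> ennreal (sqrt c)"
proof -
  have "enn2real (\<integral>\<^sup>+x. ennreal ((norm (g x))\<^sup>2) \<partial>lebesgue_on S) \<le> c"
    using enn2real_mono[OF I] c by simp
  moreover have "(\<integral>\<^sup>+x. ennreal ((norm (g x))\<^sup>2) \<partial>lebesgue_on S) \<noteq> \<infinity>"
    using I by (auto simp: top_unique)
  ultimately show ?thesis
    unfolding L2_norm_on_def Let_def by (simp add: ennreal_leI)
qed

text \<open>The bound for a single extension. Passing from Heaviside to sigmoidal neurons costs an
  arbitrarily small error, absorbed by doubling the bound on the squared error; this needs
  \<open>B > 0\<close>. If \<open>B = 0\<close>, then \<open>f\<close> vanishes almost everywhere on the cube.\<close>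

proposition barron_extension_approx:
  fixes f fe :: "real^'d \<Rightarrow> complex"
  assumes \<sigma>: "sigmoidal \<sigma>" and n: "n \<ge> 1" and fe: "fe \<in> L1_extensions (cbox 0 1) f"
  shows "(INF g\<in>shallow_nets \<sigma> n. L2_norm_on (cbox 0 1) (\<lambda>x. f x - g x))
    \<le> ennreal (2 * pi * sqrt (4 * sqrt CARD('d) + 6) * real n powr (- 1/2))
      * (\<integral>\<^sup>+\<xi>. ennreal ((1 + norm \<xi>) powr (1/2) * norm (fourier fe \<xi>)) \<partial>lebesgue)"
    (is "?lhs \<le> ennreal ?c * ?B")
proof (cases "?B = \<infinity>")
  case True
  have "?c > 0" using n by (simp add: add_nonneg_pos)
  then have "ennreal ?c \<noteq> 0" by (simp only: ennreal_eq_0_iff not_le)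
  then have "ennreal ?c * ?B = top"
    unfolding True infinity_ennreal_def ennreal_mult_eq_top_iff by simp
  then show ?thesis
    by simp
next
  case False
  define \<kappa> where "\<kappa> = 4 * sqrt CARD('d) + 6"
  have \<kappa>: "\<kappa> > 0" by (simp add: \<kappa>_def add_nonneg_pos)
  have fe_int: "integrable lebesgue fe" and fe_eq: "AE x in lebesgue_on (cbox 0 1). fe x = f x"
    using fe by (auto simp: L1_extensions_def)
  obtain fb where [measurable]: "fb \<in> borel_measurable borel" and fb: "AE x in lborel. fe x = fb x"
    using lebesgue_ex_borel_complex[of fe] fe_int by auto
  have fb': "AE x in lebesgue. fe x = fb x"
    using fb by (simp add: AE_completion_iff)
  have fb_int: "integrable lborel fb"
  proof -
    have fb_meas: "fb \<in> borel_measurable lebesgue"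
      by (rule measurable_completion) measurable
    have "integrable lebesgue fb"
      using integrable_cong_AE[OF _ fb_meas fb'] fe_int by auto
    then show ?thesis
      by (simp add: integrable_completion)
  qed
  define F where "F = (\<lambda>\<xi>. LINT x|lborel. fb x * cis (- 2 * pi * (\<xi> \<bullet> x)))"
  have F[measurable]: "F \<in> borel_measurable borel"
    unfolding F_def by measurable
  have fourier: "fourier fe \<xi> = F \<xi>" for \<xi>
  proof -
    have e: "exp (- 2 * complex_of_real pi * \<i> * complex_of_real (\<xi> \<bullet> x)) = cis (- 2 * pi * (\<xi> \<bullet> x))" for x
      by (simp add: cis_conv_exp mult_ac)
    have "fourier fe \<xi> = (LINT x|lebesgue. fb x * cis (- 2 * pi * (\<xi> \<bullet> x)))"
      unfolding fourier_def e
    proof (rule integral_cong_AE)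
      show "AE x in lebesgue. fe x * cis (- 2 * pi * (\<xi> \<bullet> x)) = fb x * cis (- 2 * pi * (\<xi> \<bullet> x))"
        using fb' by eventually_elim simp
      have "(\<lambda>x. cis (- 2 * pi * (\<xi> \<bullet> x))) \<in> borel_measurable lebesgue"
        by (rule measurable_completion) measurable
      then show "(\<lambda>x. fe x * cis (- 2 * pi * (\<xi> \<bullet> x))) \<in> borel_measurable lebesgue"
        using fe_int by (intro borel_measurable_times) auto
      show "(\<lambda>x. fb x * cis (- 2 * pi * (\<xi> \<bullet> x))) \<in> borel_measurable lebesgue"
        by (rule measurable_completion) measurable
    qed
    also have "\<dots> = F \<xi>"
      unfolding F_def by (rule integral_completion) measurable
    finally show ?thesis .
  qed
  have B_eq: "?B = (\<integral>\<^sup>+\<xi>. ennreal (sqrt (1 + norm \<xi>) * norm (F \<xi>)) \<partial>lborel)"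
    unfolding fourier nn_integral_completion by (simp add: powr_half_sqrt)
  have int: "integrable lborel (\<lambda>\<xi>. sqrt (1 + norm \<xi>) * norm (F \<xi>))"
    using False unfolding B_eq by (intro integrableI_nonneg) (auto simp: less_top)
  define B where "B = (LINT \<xi>|lborel. sqrt (1 + norm \<xi>) * norm (F \<xi>))"
  have B0: "B \<ge> 0" unfolding B_def by (intro integral_nonneg_AE) simp
  have B: "?B = ennreal B"
    unfolding B_eq B_def by (rule nn_integral_eq_integral[OF int]) simp
  have F_int: "integrable lborel F"
    by (rule Bochner_Integration.integrable_bound[OF int])
      (auto simp: abs_mult mult_right_mono[of 1 _ "norm (F _)", simplified])
  define q where "q = (\<lambda>x. LINT \<xi>|lborel. F \<xi> * cis (2 * pi * (\<xi> \<bullet> x)))"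
  have q_meas[measurable]: "q \<in> borel_measurable borel"
    unfolding q_def by measurable
  have "AE x in lborel. fb x = q x"
    unfolding q_def F_def by (rule fourier_inversion[OF fb_int F_int[unfolded F_def]])
  then have "AE x in lebesgue. fb x = q x"
    by (simp add: AE_completion_iff)
  with fb' have "AE x in lebesgue. fe x = q x"
    by eventually_elim simp
  then have "AE x in lebesgue_on (cbox 0 1). fe x = q x"
    by (auto simp: AE_restrict_space_iff elim: eventually_mono)
  with fe_eq have fq: "AE x in lebesgue_on (cbox 0 1). f x = q x"
    by eventually_elim simp
  have L2: "(\<integral>\<^sup>+x. ennreal ((norm (f x - g x))\<^sup>2) \<partial>lebesgue_on (cbox 0 1))
      = (\<integral>\<^sup>+x. ennreal ((norm (q x - g x))\<^sup>2) \<partial>restrict_space lborel (cbox 0 1))" for g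
  proof -
    have "(\<integral>\<^sup>+x. ennreal ((norm (f x - g x))\<^sup>2) \<partial>lebesgue_on (cbox 0 1))
      = (\<integral>\<^sup>+x. ennreal ((norm (q x - g x))\<^sup>2) \<partial>lebesgue_on (cbox 0 1))"
      by (rule nn_integral_cong_AE) (use fq in eventually_elim, simp)
    then show ?thesis
      by (simp add: nn_integral_lebesgue_on)
  qed
  define c where "c = 4 * pi\<^sup>2 * \<kappa> * B\<^sup>2 / real n"
  have "\<exists>g\<in>shallow_nets \<sigma> n. (\<integral>\<^sup>+x. ennreal ((norm (q x - g x))\<^sup>2) \<partial>restrict_space lborel (cbox 0 1)) \<le> ennreal c"
  proof (cases "B = 0")
    case True
    have "AE \<xi> in lborel. sqrt (1 + norm \<xi>) * norm (F \<xi>) = 0"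
      using True unfolding B_def by (subst (asm) integral_nonneg_eq_0_iff_AE[OF int]) simp_all
    then have F0: "AE \<xi> in lborel. F \<xi> = 0"
      by eventually_elim (simp add: add_nonneg_eq_0_iff)
    have "q x = 0" for x
      unfolding q_def by (rule integral_eq_zero_AE) (use F0 in eventually_elim, simp)
    then show ?thesis
      by (intro bexI[OF _ shallow_nets_zero]) simp
  next
    case False
    then have "B > 0" using B0 by simp
    have "\<exists>h\<in>shallow_nets heaviside n.
        (\<integral>\<^sup>+x. ennreal ((norm (q x - h x))\<^sup>2) \<partial>restrict_space lborel (cbox 0 1))
          \<le> ennreal (2 * pi\<^sup>2 * \<kappa> * B\<^sup>2 / real n)"
      using \<open>B > 0\<close> unfolding q_def B_def \<kappa>_def
      by (rule fourier_integral_approx_by_heaviside_nets[OF F int _ n])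
    then obtain h where h: "h \<in> shallow_nets heaviside n"
      and le: "(\<integral>\<^sup>+x. ennreal ((norm (q x - h x))\<^sup>2) \<partial>restrict_space lborel (cbox 0 1))
        \<le> ennreal (2 * pi\<^sup>2 * \<kappa> * B\<^sup>2 / real n)"
      by (elim bexE)
    note le
    also have "ennreal (2 * pi\<^sup>2 * \<kappa> * B\<^sup>2 / real n) < ennreal c"
      unfolding c_def using \<open>B > 0\<close> \<kappa> n by (intro ennreal_lessI divide_strict_right_mono mult_strict_right_mono) auto
    finally have less: "(\<integral>\<^sup>+x. ennreal ((norm (q x - h x))\<^sup>2) \<partial>restrict_space lborel (cbox 0 1)) < ennreal c" .
    have "norm (q x) \<le> (LINT \<xi>|lborel. norm (F \<xi>))" for x
      unfolding q_def by (rule order_trans[OF integral_norm_bound]) (simp add: norm_mult)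
    from heaviside_nets_approx_by_sigmoidal_nets[OF \<sigma> h q_meas this less] show ?thesis
      by (meson less_imp_le)
  qed
  then obtain g where g: "g \<in> shallow_nets \<sigma> n"
    and "(\<integral>\<^sup>+x. ennreal ((norm (f x - g x))\<^sup>2) \<partial>lebesgue_on (cbox 0 1)) \<le> ennreal c"
    unfolding L2[symmetric] by blast
  then have "?lhs \<le> ennreal (sqrt c)"
    using \<kappa> by (intro INF_lower2[OF g] L2_norm_on_le) (simp_all add: c_def)
  also have "sqrt c = ?c * B"
    unfolding c_def \<kappa>_def[symmetric] using B0
    by (simp add: real_sqrt_mult real_sqrt_divide powr_minus powr_half_sqrt field_simps)
  also have "ennreal (?c * B) = ennreal ?c * ?B"
    unfolding B using B0 by (intro ennreal_mult) (auto simp: add_nonneg_nonneg)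
  finally show ?thesis .
qed

theorem theorem5:
  shows "\<exists>C::real. C > 0 \<and>
    (\<forall>(\<sigma>::real \<Rightarrow> real) (f::real^'d::finite \<Rightarrow> complex) (n::nat).
       sigmoidal \<sigma> \<longrightarrow> f \<in> barron_space (1/2) (cbox 0 1) \<longrightarrow> n \<ge> 1 \<longrightarrow>
       (INF g\<in>shallow_nets \<sigma> n. L2_norm_on (cbox 0 1) (\<lambda>x. f x - g x))
         \<le> ennreal C * barron_norm (1/2) (cbox 0 1) f * ennreal (real n powr (- 1/2)))"
proof (intro exI[of _ "2 * pi * sqrt (4 * sqrt CARD('d) + 6)"] conjI allI impI)
  let ?C = "2 * pi * sqrt (4 * sqrt CARD('d) + 6)"
  show C: "?C > 0"
    by (simp add: add_nonneg_pos)
  fix \<sigma> :: "real \<Rightarrow> real" and f :: "real^'d \<Rightarrow> complex" and n :: nat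
  assume \<sigma>: "sigmoidal \<sigma>" and n: "n \<ge> 1"
  let ?E = "INF g\<in>shallow_nets \<sigma> n. L2_norm_on (cbox 0 1) (\<lambda>x. f x - g x)"
  define r where "r = ?C * real n powr (- 1/2)"
  have r: "r > 0" using C n by (simp add: r_def)
  have cancel: "ennreal (1 / r) * ennreal r = 1" "ennreal r * ennreal (1 / r) = 1"
    using r by (simp_all flip: ennreal_mult)
  have "ennreal (1 / r) * ?E \<le> barron_norm (1/2) (cbox 0 1) f"
    unfolding barron_norm_def
  proof (rule INF_greatest)
    fix fe assume "fe \<in> L1_extensions (cbox 0 1) f"
    then have "ennreal (1 / r) * ?E \<le> ennreal (1 / r) * (ennreal r *
        (\<integral>\<^sup>+\<xi>. ennreal ((1 + norm \<xi>) powr (1/2) * norm (fourier fe \<xi>)) \<partial>lebesgue))"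
      unfolding r_def by (intro mult_left_mono barron_extension_approx \<sigma> n) auto
    then show "ennreal (1 / r) * ?E \<le> (\<integral>\<^sup>+\<xi>. ennreal ((1 + norm \<xi>) powr (1/2) * norm (fourier fe \<xi>)) \<partial>lebesgue)"
      by (simp only: mult.assoc[symmetric] cancel mult_1)
  qed
  then have "ennreal r * (ennreal (1 / r) * ?E) \<le> ennreal r * barron_norm (1/2) (cbox 0 1) f"
    by (rule mult_left_mono) simp
  then have "?E \<le> ennreal r * barron_norm (1/2) (cbox 0 1) f"
    by (simp only: mult.assoc[symmetric] cancel mult_1)
  also have "ennreal r = ennreal ?C * ennreal (real n powr (- 1/2))"
    unfolding r_def using C by (intro ennreal_mult) auto
  finally show "?E \<le> ennreal ?C * barron_norm (1/2) (cbox 0 1) f * ennreal (real n powr (- 1/2))"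
    by (simp only: mult_ac)
qed

end
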